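(* Let $\mathcal{A}$ be a finite-dimensional $C^*$-algebra with unit $\mathbf 1$ and let $\tau$ be a faithful tracial positive linear functional on $\mathcal A$. Let $(\mathscr P_t)_{t\ge 0}$, $\mathscr P_t=e^{t\mathscr L}$, be an ergodic quantum Markov semigroup on $\mathcal A$ with generator $\mathscr L$ and invariant state $\sigma\in\mathfrak P_+$. Suppose there exists a continuously differentiable Riemannian metric $(g_\rho)_{\rho\in\mathfrak P_+}$ on $\mathfrak P_+$ such that the quantum master equation $\partial_t\rho=\mathscr L^\dagger\rho$ is the gradient flow equation of the relative entropy $\mathrm{Ent}_\sigma$ with respect to $(g_\rho)$, i.e. $$ g_\rho(A,\mathscr L^\dagger\rho)=-\tau\big[A(\log\rho-\log\sigma)\big]\qquad\text{for all }\rho\in\mathfrak P_+,\ A\in\mathcal A_0 .$$ Then for each $t\ge 0$ the operator $\mathscr P_t$ is self-adjoint with respect to the BKM inner product associated to $\sigma$, that is, $$\langle \mathscr P_tA,B\rangle_{L^2_{\rm BKM}(\sigma)}=\langle A,\mathscr P_tB\rangle_{L^2_{\rm BKM}(\sigma)}\qquad\text{for all }A,B\in\mathcal A .$$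
   Context: $\mathcal A_h$ is the set of self-adjoint elements of $\mathcal A$. $\mathfrak P_+$ is the set of positive definite $\rho\in\mathcal A$ with $\tau[\rho]=1$; it is a relatively open subset of $\{A\in\mathcal A_h:\tau[A]=1\}$, and its tangent space at each point is identified with $\mathcal A_0:=\{A\in\mathcal A_h:\tau[A]=0\}$. A Riemannian metric on $\mathfrak P_+$ is a family of positive definite symmetric bilinear forms $g_\rho:\mathcal A_0\times\mathcal A_0\to\mathbb R$; it is continuously differentiable if it depends on $\rho$ in a $C^1$ way. A quantum Markov semigroup on $\mathcal A$ is a $C_0$-semigroup of linear operators $(\mathscr P_t)_{t\ge0}$ on $\mathcal A$ such that each $\mathscr P_t$ is completely positive and $\mathscr P_t\mathbf 1=\mathbf 1$. It is ergodic if $\ker\mathscr L=\mathrm{lin}\{\mathbf 1\}$. The symbol $\dagger$ denotes the adjoint with respect to $\langle A,B\rangle_{L^2(\mathcal A,\tau)}=\tau[A^*B]$. The state $\sigma$ is invariant if $\mathscr P_t^\dagger\sigma=\sigma$ for all $t$. The relative entropy is $\mathrm{Ent}_\sigma(\rho)=\tau[\rho(\log\rho-\log\sigma)]$; its differential at $\rho\in\mathfrak P_+$ is $\log\rho-\log\sigma$. The gradient $\nabla_g\mathrm{Ent}_\sigma(\rho)\in\mathcal A_0$ is determined by $g_\rho(A,\nabla_g\mathrm{Ent}_\sigma(\rho))=\tau[A(\log\rho-\log\sigma)]$ for all $A\in\mathcal A_0$, and the gradient flow equation is $\partial_t\rho=-\nabla_g\mathrm{Ent}_\sigma(\rho)$.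 The BKM inner product is $\langle A,B\rangle_{L^2_{\rm BKM}(\sigma)}=\int_0^1\tau[A^*\sigma^{s}B\sigma^{1-s}]\,ds$. *)

theory Defs
  imports "HOL-Analysis.Analysis"
begin

text \<open>Unital \<open>C\<^sup>*\<close>-algebras.  The real scalar multiplication, the norm topology and completeness are
  those of the library classes; the complex scalar multiplication extends the real one.  The
  superclass \<open>real_normed_algebra_1\<close> excludes only the zero algebra, which has no states.\<close>

class cstar_algebra = real_normed_algebra_1 + banach +
  fixes scaleC :: "complex \<Rightarrow> 'a \<Rightarrow> 'a"  (infixr "*\<^sub>C" 75)
    and star :: "'a \<Rightarrow> 'a"
  assumes scaleC_add_right: "c *\<^sub>C (x + y) = c *\<^sub>C x + c *\<^sub>C y"
    and scaleC_add_left: "(c + d) *\<^sub>C x = c *\<^sub>C x + d *\<^sub>C x"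
    and scaleC_scaleC: "c *\<^sub>C d *\<^sub>C x = (c * d) *\<^sub>C x"
    and scaleC_of_real: "complex_of_real r *\<^sub>C x = r *\<^sub>R x"
    and mult_scaleC_left: "(c *\<^sub>C x) * y = c *\<^sub>C (x * y)"
    and mult_scaleC_right: "x * (c *\<^sub>C y) = c *\<^sub>C (x * y)"
    and norm_scaleC: "norm (c *\<^sub>C x) = cmod c * norm x"
    and star_star: "star (star x) = x"
    and star_add: "star (x + y) = star x + star y"
    and star_mult: "star (x * y) = star y * star x"
    and star_scaleC: "star (c *\<^sub>C x) = cnj c *\<^sub>C star x"
    and norm_star_mult_self: "norm (star x * x) = (norm x)\<^sup>2"

class fin_dim_cstar_algebra = cstar_algebra +
  assumes finite_spanning_set:
    "\<exists>B. finite B \<and> (\<forall>x. \<exists>c. x = (\<Sum>b\<in>B. c b *\<^sub>C b))"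

definition selfadjoint :: "'a::cstar_algebra \<Rightarrow> bool" where
  "selfadjoint a \<longleftrightarrow> star a = a"

definition positive_definite :: "'a::cstar_algebra \<Rightarrow> bool" where
  "positive_definite a \<longleftrightarrow> (\<exists>b. a = star b * b) \<and> (\<exists>c. a * c = 1 \<and> c * a = 1)"

text \<open>For positive definite \<open>a\<close> the logarithm is the unique self-adjoint \<open>h\<close> with \<open>exp h = a\<close>, where
  \<open>exp\<close> is the exponential power series of the algebra.\<close>

definition cstar_log :: "'a::cstar_algebra \<Rightarrow> 'a" where
  "cstar_log a = (THE h. selfadjoint h \<and> exp h = a)"

definition cstar_powr :: "'a::cstar_algebra \<Rightarrow> real \<Rightarrow> 'a" where
  "cstar_powr a s = exp (s *\<^sub>R cstar_log a)"

definition faithful_trace :: "('a::cstar_algebra \<Rightarrow> complex) \<Rightarrow> bool" where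
  "faithful_trace \<tau> \<longleftrightarrow>
     (\<forall>a b. \<tau> (a + b) = \<tau> a + \<tau> b) \<and> (\<forall>c a. \<tau> (c *\<^sub>C a) = c * \<tau> a) \<and>
     (\<forall>a b. \<tau> (a * b) = \<tau> (b * a)) \<and>
     (\<forall>a. \<tau> (star a * a) \<in> \<real>\<^sub>\<ge>\<^sub>0) \<and>
     (\<forall>a. \<tau> (star a * a) = 0 \<longrightarrow> a = 0)"

definition states_pos :: "('a::cstar_algebra \<Rightarrow> complex) \<Rightarrow> 'a set" where
  "states_pos \<tau> = {\<rho>. positive_definite \<rho> \<and> \<tau> \<rho> = 1}"

definition tangent :: "('a::cstar_algebra \<Rightarrow> complex) \<Rightarrow> 'a set" where
  "tangent \<tau> = {A. selfadjoint A \<and> \<tau> A = 0}"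

definition complex_linear_op :: "('a::cstar_algebra \<Rightarrow> 'a) \<Rightarrow> bool" where
  "complex_linear_op T \<longleftrightarrow>
     (\<forall>x y. T (x + y) = T x + T y) \<and> (\<forall>c x. T (c *\<^sub>C x) = c *\<^sub>C T x)"

text \<open>An \<open>n \<times> n\<close> matrix over the algebra is a function of two indices, of which only the values at
  indices below \<open>n\<close> matter.  It is positive iff it equals \<open>Y\<^sup>* Y\<close> for some matrix \<open>Y\<close>, where
  \<open>(Y\<^sup>*)\<^sub>i\<^sub>k = star (Y\<^sub>k\<^sub>i)\<close>.\<close>

definition positive_mat :: "nat \<Rightarrow> (nat \<Rightarrow> nat \<Rightarrow> 'a::cstar_algebra) \<Rightarrow> bool" where
  "positive_mat n X \<longleftrightarrow>
     (\<exists>Y. \<forall>i<n. \<forall>j<n. X i j = (\<Sum>k<n. star (Y k i) * Y k j))"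

definition completely_positive :: "('a::cstar_algebra \<Rightarrow> 'a) \<Rightarrow> bool" where
  "completely_positive T \<longleftrightarrow>
     (\<forall>n X. positive_mat n X \<longrightarrow> positive_mat n (\<lambda>i j. T (X i j)))"

definition quantum_markov_semigroup :: "(real \<Rightarrow> 'a::cstar_algebra \<Rightarrow> 'a) \<Rightarrow> bool" where
  "quantum_markov_semigroup P \<longleftrightarrow>
     (\<forall>t\<ge>0. complex_linear_op (P t)) \<and>
     (\<forall>A. P 0 A = A) \<and>
     (\<forall>s\<ge>0. \<forall>t\<ge>0. \<forall>A. P (s + t) A = P s (P t A)) \<and>
     (\<forall>A. ((\<lambda>t. P t A) \<longlongrightarrow> A) (at_right 0)) \<and>
     (\<forall>t\<ge>0. completely_positive (P t) \<and> P t 1 = 1)"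

definition is_generator ::
    "(real \<Rightarrow> 'a::cstar_algebra \<Rightarrow> 'a) \<Rightarrow> ('a \<Rightarrow> 'a) \<Rightarrow> bool" where
  "is_generator P L \<longleftrightarrow>
     (\<forall>A. ((\<lambda>t. (1 / t) *\<^sub>R (P t A - A)) \<longlongrightarrow> L A) (at_right 0))"

definition ergodic_generator :: "('a::cstar_algebra \<Rightarrow> 'a) \<Rightarrow> bool" where
  "ergodic_generator L \<longleftrightarrow> {A. L A = 0} = range (\<lambda>c. c *\<^sub>C 1)"

text \<open>The adjoint \<open>T\<^sup>\<dagger>\<close> with respect to the inner product \<open>\<tau> (star A * B)\<close>.\<close>

definition tr_adjoint :: "('a::cstar_algebra \<Rightarrow> complex) \<Rightarrow> ('a \<Rightarrow> 'a) \<Rightarrow> 'a \<Rightarrow> 'a" where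
  "tr_adjoint \<tau> T = (THE S. \<forall>A B. \<tau> (star (T A) * B) = \<tau> (star A * S B))"

definition riemannian_metric ::
    "('a::cstar_algebra \<Rightarrow> complex) \<Rightarrow> ('a \<Rightarrow> 'a \<Rightarrow> 'a \<Rightarrow> real) \<Rightarrow> bool" where
  "riemannian_metric \<tau> g \<longleftrightarrow>
     (\<forall>\<rho>\<in>states_pos \<tau>.
        (\<forall>A\<in>tangent \<tau>. \<forall>B\<in>tangent \<tau>. \<forall>C\<in>tangent \<tau>. g \<rho> (A + B) C = g \<rho> A C + g \<rho> B C) \<and>
        (\<forall>r. \<forall>A\<in>tangent \<tau>. \<forall>B\<in>tangent \<tau>. g \<rho> (r *\<^sub>R A) B = r * g \<rho> A B) \<and>
        (\<forall>A\<in>tangent \<tau>. \<forall>B\<in>tangent \<tau>. g \<rho> A B = g \<rho> B A) \<and>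
        (\<forall>A\<in>tangent \<tau>. A \<noteq> 0 \<longrightarrow> 0 < g \<rho> A A))"

text \<open>All coefficient functions \<open>\<rho> \<mapsto> g\<^sub>\<rho>(A, B)\<close> are \<open>C\<^sup>1\<close> on \<open>states_pos \<tau>\<close>, a relatively open subset
  of an affine subspace.  Only the restriction of \<open>D \<rho>\<close> to \<open>tangent \<tau>\<close> is determined by the derivative
  within \<open>states_pos \<tau>\<close>; its values elsewhere are an arbitrary continuous extension, which exists
  whenever the restriction is continuous in \<open>\<rho>\<close>.\<close>

definition C1_metric ::
    "('a::cstar_algebra \<Rightarrow> complex) \<Rightarrow> ('a \<Rightarrow> 'a \<Rightarrow> 'a \<Rightarrow> real) \<Rightarrow> bool" where
  "C1_metric \<tau> g \<longleftrightarrow>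
     (\<forall>A\<in>tangent \<tau>. \<forall>B\<in>tangent \<tau>. \<exists>D :: 'a \<Rightarrow> 'a \<Rightarrow>\<^sub>L real.
        continuous_on (states_pos \<tau>) D \<and>
        (\<forall>\<rho>\<in>states_pos \<tau>.
           ((\<lambda>\<rho>'. g \<rho>' A B) has_derivative blinfun_apply (D \<rho>)) (at \<rho> within states_pos \<tau>)))"

definition bkm_inner :: "('a::cstar_algebra \<Rightarrow> complex) \<Rightarrow> 'a \<Rightarrow> 'a \<Rightarrow> 'a \<Rightarrow> complex" where
  "bkm_inner \<tau> \<sigma> A B =
     integral {0..1} (\<lambda>s. \<tau> (star A * cstar_powr \<sigma> s * B * cstar_powr \<sigma> (1 - s)))"

end

theory Submission
  imports Defs "HOL-Computational_Algebra.Fundamental_Theorem_Algebra"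
begin

text \<open>The gradient flow equation is a family of identities, one for each state \<open>\<rho>\<close>, and only its first
  order at the equilibrium \<open>\<sigma>\<close> carries the claim.  Write \<open>h = log \<sigma>\<close>, \<open>K = L\<^sup>\<dagger>\<close> and
  \<open>M x = \<integral>\<^sub>0\<^sup>1 e\<^bsup>sh\<^esup> x e\<^bsup>(1-s)h\<^esup> ds\<close>; thus \<open>M\<close> is the differential of the exponential map
  at \<open>h\<close>, and the BKM inner product of \<open>a\<close> and \<open>b\<close> is \<open>\<tau>(a\<^sup>* M b)\<close>.

  Instead of a straight line through \<open>\<sigma>\<close>, along which the logarithm would have to be differentiated,
  the curve used is the normalized exponential of \<open>h + e x\<close> with \<open>x\<close> self-adjoint.  Its logarithm is
  \<open>h + e x\<close> up to a multiple of \<open>1\<close>, which no traceless \<open>a\<close> sees, and \<open>K\<close> annihilates \<open>\<sigma>\<close>.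
  Dividing by \<open>e\<close> and letting \<open>e \<rightarrow> 0\<close> gives \<open>g\<^sub>\<sigma>(a, K M x) = - \<tau>(a x)\<close>
  for every tangent vector \<open>a\<close> (\<open>gradient_flow_linearized\<close>).
  For self-adjoint \<open>y\<close> the element \<open>a = K M y\<close> is again a tangent vector, so the symmetry of \<open>g\<^sub>\<sigma>\<close>
  yields \<open>\<tau>(K M y x) = \<tau>(K M x y)\<close>.  Because \<open>M\<close> is symmetric for the trace pairing, this says that
  \<open>L\<close> is symmetric for the BKM pairing (\<open>generator_bkm_symmetric\<close>), and the symmetry passes to the
  semigroup by differentiating \<open>s \<mapsto> \<tau>(P\<^sub>s x M (P\<^bsub>t-s\<^esub> y))\<close>.

  Two groups of auxiliary results make this rigorous.  The trace turns the algebra into a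
  finite-dimensional Hilbert space: linear maps are bounded and have adjoints.  And the logarithm,
  defined as the unique self-adjoint solution of \<open>exp h = a\<close>, has to be shown to exist, by a spectral
  decomposition (\<open>selfadjoint_logarithm_exists\<close>), and to be unique, by a monotonicity property of the
  exponential (\<open>exp_inj_selfadjoint\<close>).\<close>

section \<open>Complex scalars and the involution\<close>

lemma scaleC_zero_left [simp]: "0 *\<^sub>C (x::'a::cstar_algebra) = 0"
  using scaleC_of_real[of 0 x] by simp

lemma scaleC_one [simp]: "1 *\<^sub>C (x::'a::cstar_algebra) = x"
  using scaleC_of_real[of 1 x] by simp

lemma bounded_linear_scaleC: "bounded_linear (\<lambda>x::'a::cstar_algebra. c *\<^sub>C x)"
proof (rule bounded_linear_intro)
  show "norm (c *\<^sub>C x) \<le> norm x * cmod c" for x :: 'a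
    by (simp add: norm_scaleC)
  show "c *\<^sub>C r *\<^sub>R x = r *\<^sub>R c *\<^sub>C x" for r and x :: 'a
    by (simp add: scaleC_of_real[symmetric] scaleC_scaleC mult.commute)
qed (rule scaleC_add_right)

lemma bounded_linear_scaleC_left: "bounded_linear (\<lambda>c. c *\<^sub>C (x::'a::cstar_algebra))"
proof (rule bounded_linear_intro)
  show "norm (c *\<^sub>C x) \<le> norm c * norm x" for c
    by (simp add: norm_scaleC)
  show "(r *\<^sub>R c) *\<^sub>C x = r *\<^sub>R c *\<^sub>C x" for r c
    by (simp only: scaleR_conv_of_real[where 'a = complex] scaleC_scaleC[symmetric] scaleC_of_real)
qed (rule scaleC_add_left)

lemma scaleC_zero_right [simp]: "c *\<^sub>C (0::'a::cstar_algebra) = 0"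
  and scaleC_diff_right: "c *\<^sub>C (x - y :: 'a) = c *\<^sub>C x - c *\<^sub>C y"
  and scaleC_sum_right: "c *\<^sub>C (\<Sum>i\<in>I. f i :: 'a) = (\<Sum>i\<in>I. c *\<^sub>C f i)"
  by (rule linear_0 linear_diff linear_sum,
      rule bounded_linear.linear[OF bounded_linear_scaleC])+

lemma scaleC_minus_left: "(- c) *\<^sub>C (x::'a::cstar_algebra) = - (c *\<^sub>C x)"
  using scaleC_add_left[of "- c" c x] by (simp add: eq_neg_iff_add_eq_0)

lemma scaleC_diff_left: "(c - d) *\<^sub>C (x::'a::cstar_algebra) = c *\<^sub>C x - d *\<^sub>C x"
  using scaleC_add_left[of c "- d" x] by (simp add: scaleC_minus_left)

lemma star_one [simp]: "star (1::'a::cstar_algebra) = 1"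
  by (metis mult.right_neutral mult.left_neutral star_mult star_star)

lemma star_scaleR: "star (r *\<^sub>R x) = r *\<^sub>R star (x::'a::cstar_algebra)"
  by (metis complex_cnj_complex_of_real scaleC_of_real star_scaleC)

lemma norm_star: "norm (star x) = norm (x::'a::cstar_algebra)"
proof -
  have le: "norm y \<le> norm (star y)" for y :: 'a
  proof (cases "y = 0")
    case False
    have "norm y * norm y \<le> norm (star y) * norm y"
      using norm_star_mult_self[of y] norm_mult_ineq[of "star y" y] by (simp add: power2_eq_square)
    with False show ?thesis by simp
  qed simp
  show ?thesis using le[of x] le[of "star x"] by (simp add: star_star)
qed

lemma bounded_linear_star: "bounded_linear (star :: 'a::cstar_algebra \<Rightarrow> 'a)"
  by (rule bounded_linear_intro[where K = 1]) (simp_all add: star_add star_scaleR norm_star)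

lemma star_zero [simp]: "star (0::'a::cstar_algebra) = 0"
  and star_diff: "star (x - y :: 'a) = star x - star y"
  and star_sum: "star (\<Sum>i\<in>I. f i :: 'a) = (\<Sum>i\<in>I. star (f i))"
  by (rule linear_0 linear_diff linear_sum,
      rule bounded_linear.linear[OF bounded_linear_star])+

lemma star_power: "star (x ^ n) = star (x::'a::cstar_algebra) ^ n"
  by (induction n) (simp_all add: star_mult power_commutes)

lemma star_exp: "star (exp x) = exp (star (x::'a::cstar_algebra))"
proof -
  have "(\<lambda>n. star (x ^ n /\<^sub>R fact n)) sums star (exp x)"
    by (rule bounded_linear.sums[OF bounded_linear_star exp_converges])
  then have "(\<lambda>n. star x ^ n /\<^sub>R fact n) sums star (exp x)"
    by (simp add: star_scaleR star_power)
  then show ?thesis using exp_converges sums_unique2 by blast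
qed

lemma selfadjoint_exp: "selfadjoint h \<Longrightarrow> selfadjoint (exp (h::'a::cstar_algebra))"
  by (simp add: selfadjoint_def star_exp)

text \<open>Real and imaginary parts: the reason why complex-linear identities need only be checked on
  self-adjoint elements.\<close>

lemma selfadjoint_decomposition:
  fixes x :: "'a::cstar_algebra"
  obtains u v where "selfadjoint u" "selfadjoint v" "x = u + \<i> *\<^sub>C v"
proof
  let ?u = "(1/2) *\<^sub>C (x + star x)" and ?v = "(- \<i> / 2) *\<^sub>C (x - star x)"
  show "selfadjoint ?u" "selfadjoint ?v"
    by (simp_all add: selfadjoint_def star_scaleC star_add star_diff star_star
        scaleC_add_right scaleC_diff_right add.commute scaleC_minus_left)
  have "?u + \<i> *\<^sub>C ?v = (1/2) *\<^sub>C (x + x)"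
    by (simp add: scaleC_scaleC scaleC_add_right scaleC_diff_right)
  also have "\<dots> = x"
    by (simp only: scaleC_add_right scaleC_add_left[symmetric]) simp
  finally show "x = ?u + \<i> *\<^sub>C ?v" by simp
qed

lemma complex_linear_op_sum:
  assumes "complex_linear_op (T :: 'a::cstar_algebra \<Rightarrow> 'a)"
  shows "T (\<Sum>i\<in>I. c i *\<^sub>C f i) = (\<Sum>i\<in>I. c i *\<^sub>C T (f i))"
proof -
  have "T 0 = 0" using assms by (metis complex_linear_op_def scaleC_zero_left)
  then show ?thesis using assms
    by (induction I rule: infinite_finite_induct) (simp_all add: complex_linear_op_def)
qed

section \<open>The exponential map of a Banach algebra\<close>

text \<open>Duhamel's formula comes from differentiating \<open>s \<mapsto> exp (s h) exp ((1 - s) k)\<close>.\<close>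

lemma exp_interpolation_derivative:
  fixes h k :: "'a::{real_normed_algebra_1,banach}"
  shows "((\<lambda>s. exp (s *\<^sub>R h) * exp ((1 - s) *\<^sub>R k)) has_vector_derivative
           exp (s *\<^sub>R h) * (h - k) * exp ((1 - s) *\<^sub>R k)) (at s within S)"
proof -
  have 1: "((\<lambda>s. exp (s *\<^sub>R h)) has_vector_derivative exp (s *\<^sub>R h) * h) (at s within S)"
    by (rule exp_scaleR_has_vector_derivative_right)
  have "((\<lambda>s. 1 - s) has_vector_derivative - 1) (at s within S)"
    by (auto intro!: derivative_eq_intros)
  from vector_diff_chain_within[OF this
      has_vector_derivative_at_within[OF exp_scaleR_has_vector_derivative_left]]
  have 2: "((\<lambda>s. exp ((1 - s) *\<^sub>R k)) has_vector_derivative - (k * exp ((1 - s) *\<^sub>R k))) (at s within S)"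
    by (simp add: o_def)
  show ?thesis
    using has_vector_derivative_mult[OF 1 2] by (simp add: algebra_simps)
qed

lemma exp_difference_integral:
  fixes h k :: "'a::{real_normed_algebra_1,banach}"
  shows "((\<lambda>s. exp (s *\<^sub>R h) * (h - k) * exp ((1 - s) *\<^sub>R k)) has_integral exp h - exp k) {0..1}"
  using fundamental_theorem_of_calculus[OF _ exp_interpolation_derivative[of h k], of 0 1] by simp

lemma norm_exp_conjugation_le:
  fixes h k x :: "'a::{real_normed_algebra_1,banach}"
  assumes "s \<in> {0..1}"
  shows "norm (exp (s *\<^sub>R h) * x * exp ((1 - s) *\<^sub>R k)) \<le> norm x * exp (norm h + norm k)"
proof -
  have "norm (exp (s *\<^sub>R h)) \<le> exp (norm h)" "norm (exp ((1 - s) *\<^sub>R k)) \<le> exp (norm k)"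
    using assms norm_exp[of "s *\<^sub>R h"] norm_exp[of "(1 - s) *\<^sub>R k"]
    by (auto elim!: order_trans simp: mult_left_le_one_le)
  then have "norm (exp (s *\<^sub>R h)) * norm x * norm (exp ((1 - s) *\<^sub>R k))
      \<le> exp (norm h) * norm x * exp (norm k)"
    by (intro mult_mono) auto
  then show ?thesis
    by (intro order_trans[OF norm_mult_ineq] order_trans[OF mult_right_mono[OF norm_mult_ineq]])
      (auto simp: exp_add algebra_simps)
qed

lemma norm_exp_difference_le:
  fixes h k :: "'a::{real_normed_algebra_1,banach}"
  shows "norm (exp h - exp k) \<le> norm (h - k) * exp (norm h + norm k)"
  using has_integral_bound[of "norm (h - k) * exp (norm h + norm k)"
      "\<lambda>s. exp (s *\<^sub>R h) * (h - k) * exp ((1 - s) *\<^sub>R k)" "exp h - exp k" 0 1]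
  by (simp add: exp_difference_integral norm_exp_conjugation_le)

lemma continuous_on_exp_conjugation:
  fixes h k x :: "'a::{real_normed_algebra_1,banach}"
  shows "continuous_on S (\<lambda>s. exp (s *\<^sub>R h) * x * exp ((1 - s) *\<^sub>R k))"
proof -
  have c: "continuous_on T (\<lambda>s. exp (s *\<^sub>R y))" for y :: 'a and T
    by (rule continuous_on_vector_derivative) (rule exp_scaleR_has_vector_derivative_right)
  have "continuous_on S (\<lambda>s. exp ((1 - s) *\<^sub>R k))"
    by (rule continuous_on_compose2[OF c[of UNIV k], of S "\<lambda>s. 1 - s"]) (auto intro!: continuous_intros)
  with c show ?thesis by (intro continuous_intros)
qed

text \<open>The operator \<open>X \<mapsto> \<integral>\<^sub>0\<^sup>1 e\<^bsup>sh\<^esup> X e\<^bsup>(1-s)h\<^esup> ds\<close> plays two roles: it is the differential of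
  the exponential map at \<open>h\<close>, and for \<open>h = log \<sigma>\<close> it represents the BKM inner product in terms of
  the trace.\<close>

definition bkm_op :: "'a::{real_normed_algebra_1,banach} \<Rightarrow> 'a \<Rightarrow> 'a" where
  "bkm_op h x = integral {0..1} (\<lambda>s. exp (s *\<^sub>R h) * x * exp ((1 - s) *\<^sub>R h))"

lemma has_integral_bkm_op:
  "((\<lambda>s. exp (s *\<^sub>R h) * x * exp ((1 - s) *\<^sub>R h)) has_integral bkm_op h x) {0..1}"
  unfolding bkm_op_def
  by (intro integrable_integral integrable_continuous_interval continuous_on_exp_conjugation)

text \<open>Duhamel's formula for \<open>h + e x\<close> and \<open>h\<close> writes the difference quotient as an integral of the same
  shape as \<open>bkm_op h x\<close>; since \<open>exp\<close> is locally Lipschitz, the two integrands differ by \<open>O(e)\<close>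
  uniformly in \<open>s\<close>.\<close>

lemma exp_directional_derivative:
  fixes h x :: "'a::{real_normed_algebra_1,banach}"
  shows "((\<lambda>e. (exp (h + e *\<^sub>R x) - exp h) /\<^sub>R e) \<longlongrightarrow> bkm_op h x) (at 0)"
proof -
  define C where "C = norm x * norm x * exp (norm h + norm x + norm h) * exp (norm h)"
  have bound: "norm ((exp (h + e *\<^sub>R x) - exp h) /\<^sub>R e - bkm_op h x) \<le> \<bar>e\<bar> * C"
    if e: "e \<noteq> 0" "\<bar>e\<bar> \<le> 1" for e
  proof -
    let ?k = "h + e *\<^sub>R x"
    have k: "norm ?k \<le> norm h + norm x"
      using norm_triangle_ineq[of h "e *\<^sub>R x"] mult_right_mono[OF e(2), of "norm x"] by simp
    have "((\<lambda>s. (1/e) *\<^sub>R (exp (s *\<^sub>R ?k) * (?k - h) * exp ((1 - s) *\<^sub>R h)))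
            has_integral (1/e) *\<^sub>R (exp ?k - exp h)) {0..1}"
      by (intro has_integral_cmul exp_difference_integral)
    from has_integral_diff[OF this has_integral_bkm_op[of h x]] e
    have I: "((\<lambda>s. (exp (s *\<^sub>R ?k) - exp (s *\<^sub>R h)) * x * exp ((1 - s) *\<^sub>R h))
            has_integral (exp ?k - exp h) /\<^sub>R e - bkm_op h x) {0..1}"
      by (simp add: algebra_simps divide_inverse)
    have "norm ((exp (s *\<^sub>R ?k) - exp (s *\<^sub>R h)) * x * exp ((1 - s) *\<^sub>R h)) \<le> \<bar>e\<bar> * C"
      if s: "s \<in> {0..1}" for s
    proof -
      have sk: "norm (s *\<^sub>R ?k) \<le> norm h + norm x" "norm (s *\<^sub>R h) \<le> norm h"
        using s k mult_left_le_one_le[of "norm ?k" s] mult_left_le_one_le[of "norm h" s] by auto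
      have "norm (s *\<^sub>R ?k - s *\<^sub>R h) \<le> \<bar>e\<bar> * norm x"
        using s mult_left_le_one_le[of "\<bar>e\<bar> * norm x" s] by (simp add: algebra_simps abs_mult)
      moreover have "exp (norm (s *\<^sub>R ?k) + norm (s *\<^sub>R h)) \<le> exp (norm h + norm x + norm h)"
        using sk by simp
      ultimately have d: "norm (exp (s *\<^sub>R ?k) - exp (s *\<^sub>R h)) \<le> (\<bar>e\<bar> * norm x) * exp (norm h + norm x + norm h)"
        by (intro order_trans[OF norm_exp_difference_le] mult_mono) auto
      have "norm (exp ((1 - s) *\<^sub>R h)) \<le> exp (norm h)"
        using s norm_exp[of "(1 - s) *\<^sub>R h"] by (auto elim!: order_trans simp: mult_left_le_one_le)
      with d have "norm (exp (s *\<^sub>R ?k) - exp (s *\<^sub>R h)) * norm x * norm (exp ((1 - s) *\<^sub>R h))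
          \<le> (\<bar>e\<bar> * norm x) * exp (norm h + norm x + norm h) * norm x * exp (norm h)"
        by (intro mult_mono) auto
      then show ?thesis
        by (intro order_trans[OF norm_mult_ineq] order_trans[OF mult_right_mono[OF norm_mult_ineq]])
          (auto simp: C_def algebra_simps)
    qed
    with has_integral_bound[of "\<bar>e\<bar> * C", OF _ I[folded cbox_interval]] show ?thesis
      by (simp add: C_def)
  qed
  have "((\<lambda>e::real. \<bar>e\<bar> * C) \<longlongrightarrow> \<bar>0\<bar> * C) (at 0)" by (intro tendsto_intros)
  then have lim: "((\<lambda>e::real. \<bar>e\<bar> * C) \<longlongrightarrow> 0) (at 0)" by simp
  have "\<forall>\<^sub>F e in at (0::real). e \<noteq> 0 \<and> \<bar>e\<bar> \<le> 1"
    unfolding eventually_at by (rule exI[of _ 1]) auto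
  then have "\<forall>\<^sub>F e in at 0. norm ((exp (h + e *\<^sub>R x) - exp h) /\<^sub>R e - bkm_op h x) \<le> \<bar>e\<bar> * C"
    by eventually_elim (rule bound, auto)
  then have "((\<lambda>e. (exp (h + e *\<^sub>R x) - exp h) /\<^sub>R e - bkm_op h x) \<longlongrightarrow> 0) (at 0)"
    using lim by (rule Lim_null_comparison)
  then show ?thesis by (simp add: LIM_zero_iff)
qed

lemma complex_linear_bkm_op: "complex_linear_op (bkm_op (h::'a::cstar_algebra))"
proof -
  have "bkm_op h (x + y) = bkm_op h x + bkm_op h y" for x y
    using has_integral_add[OF has_integral_bkm_op[of h x] has_integral_bkm_op[of h y]]
    by (intro has_integral_unique[OF has_integral_bkm_op]) (simp add: algebra_simps)
  moreover have "bkm_op h (c *\<^sub>C x) = c *\<^sub>C bkm_op h x" for c x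
    using has_integral_linear[OF has_integral_bkm_op[of h x] bounded_linear_scaleC[of c]]
    by (intro has_integral_unique[OF has_integral_bkm_op])
      (simp add: o_def mult_scaleC_left mult_scaleC_right)
  ultimately show ?thesis by (simp add: complex_linear_op_def)
qed

lemma exp_half_mult:
  "exp ((s/2) *\<^sub>R h) * exp ((s/2) *\<^sub>R h) = exp (s *\<^sub>R (h::'a::{real_normed_algebra_1,banach}))"
  by (subst exp_add_commuting[symmetric]) (simp_all add: scaleR_add_left[symmetric])

lemma exp_invertible: "exp h * exp (- h) = (1::'a::{real_normed_algebra_1,banach})"
  "exp (- h) * exp h = (1::'a)"
  by (simp_all add: exp_add_commuting[symmetric])

lemma positive_definite_exp:
  assumes "selfadjoint (h::'a::cstar_algebra)" shows "positive_definite (exp h)"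
  unfolding positive_definite_def
proof (intro conjI exI)
  show "exp h = star (exp ((1/2) *\<^sub>R h)) * exp ((1/2) *\<^sub>R h)"
    using exp_half_mult[of 1 h] assms by (simp add: star_exp star_scaleR selfadjoint_def)
qed (rule exp_invertible)+

section \<open>The Hilbert space structure given by a faithful trace\<close>

locale faithful_trace_functional =
  fixes \<tau> :: "'a::fin_dim_cstar_algebra \<Rightarrow> complex"
  assumes faithful: "faithful_trace \<tau>"
begin

lemma trace_add: "\<tau> (a + b) = \<tau> a + \<tau> b"
  by (rule faithful[unfolded faithful_trace_def, THEN conjunct1, rule_format])

lemma trace_scaleC: "\<tau> (c *\<^sub>C a) = c * \<tau> a"
  by (rule faithful[unfolded faithful_trace_def, THEN conjunct2, THEN conjunct1, rule_format])

lemma trace_commute: "\<tau> (a * b) = \<tau> (b * a)"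
  by (rule faithful[unfolded faithful_trace_def, THEN conjunct2, THEN conjunct2, THEN conjunct1,
        rule_format])

lemma trace_nonneg: "\<tau> (star a * a) \<in> \<real>\<^sub>\<ge>\<^sub>0"
  by (rule faithful[unfolded faithful_trace_def, THEN conjunct2, THEN conjunct2, THEN conjunct2,
        THEN conjunct1, rule_format])

lemma trace_faithful: "\<tau> (star a * a) = 0 \<Longrightarrow> a = 0"
  by (rule faithful[unfolded faithful_trace_def, THEN conjunct2, THEN conjunct2, THEN conjunct2,
        THEN conjunct2, rule_format])

lemma trace_scaleR: "\<tau> (r *\<^sub>R a) = of_real r * \<tau> a"
  using trace_scaleC[of "of_real r"] by (simp add: scaleC_of_real)

lemma trace_zero [simp]: "\<tau> 0 = 0"
  using trace_add[of 0 0] by simp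

lemma trace_minus: "\<tau> (- a) = - \<tau> a"
  using trace_add[of a "- a"] by (simp add: eq_neg_iff_add_eq_0 add.commute)

lemma trace_diff: "\<tau> (a - b) = \<tau> a - \<tau> b"
  using trace_add[of a "- b"] by (simp add: trace_minus)

lemma trace_sum: "\<tau> (\<Sum>i\<in>I. f i) = (\<Sum>i\<in>I. \<tau> (f i))"
  by (induction I rule: infinite_finite_induct) (simp_all add: trace_add)

lemma Re_trace_pos: "a \<noteq> 0 \<Longrightarrow> 0 < Re (\<tau> (star a * a))"
  and Im_trace_square: "Im (\<tau> (star a * a)) = 0"
proof -
  show "Im (\<tau> (star a * a)) = 0" for a
    using trace_nonneg[of a] by (simp add: complex_nonneg_Reals_iff)
  then show "a \<noteq> 0 \<Longrightarrow> 0 < Re (\<tau> (star a * a))" for a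
    using trace_nonneg[of a] trace_faithful[of a]
    by (auto simp: complex_nonneg_Reals_iff complex_eq_iff less_le)
qed

text \<open>Positivity on \<open>(1 + a)\<^sup>*(1 + a)\<close> and \<open>(1 + ia)\<^sup>*(1 + ia)\<close> forces a positive functional to be
  Hermitian.\<close>

lemma trace_star: "\<tau> (star a) = cnj (\<tau> a)"
proof -
  have "Im (\<tau> (star (1 + c *\<^sub>C a) * (1 + c *\<^sub>C a))) = 0" for c
    by (rule Im_trace_square)
  moreover have "\<tau> (star (1 + c *\<^sub>C a) * (1 + c *\<^sub>C a))
      = \<tau> (star 1 * 1) + c * \<tau> a + cnj c * \<tau> (star a) + \<tau> (star (c *\<^sub>C a) * (c *\<^sub>C a))" for c
    by (simp add: star_add star_scaleC distrib_left distrib_right trace_add trace_scaleC)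
  ultimately have "Im (\<tau> (star 1 * 1) + c * \<tau> a + cnj c * \<tau> (star a) + \<tau> (star (c *\<^sub>C a) * (c *\<^sub>C a))) = 0" for c
    by simp
  then have "Im (c * \<tau> a + cnj c * \<tau> (star a)) = 0" for c
    by (simp only: plus_complex.sel(2) Im_trace_square add_0 add_0_right)
  from this[of 1] this[of \<i>] show ?thesis
    by (simp add: complex_eq_iff)
qed

lemma trace_mult_eqI: "(\<And>b. \<tau> (b * x) = \<tau> (b * y)) \<Longrightarrow> x = y"
  using trace_faithful[of "x - y"] by (simp add: right_diff_distrib trace_diff)

lemma trace_selfadjoint_real: "selfadjoint a \<Longrightarrow> Im (\<tau> a) = 0"
  using trace_star[of a] by (simp add: selfadjoint_def complex_eq_iff)

lemma trace_selfadjoint_mult_real: "selfadjoint a \<Longrightarrow> selfadjoint b \<Longrightarrow> Im (\<tau> (a * b)) = 0"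
  using trace_star[of "a * b"] trace_commute[of a b]
  by (simp add: selfadjoint_def star_mult complex_eq_iff)

definition orthonormal_basis :: "'a set \<Rightarrow> bool" where
  "orthonormal_basis E \<longleftrightarrow> finite E \<and> (\<forall>e\<in>E. \<forall>f\<in>E. \<tau> (star e * f) = of_bool (e = f)) \<and>
     (\<forall>x. x = (\<Sum>e\<in>E. \<tau> (star e * x) *\<^sub>C e))"

lemma gram_schmidt:
  assumes "finite B"
  shows "\<exists>E. finite E \<and> (\<forall>e\<in>E. \<forall>f\<in>E. \<tau> (star e * f) = of_bool (e = f)) \<and>
           (\<forall>b\<in>B. b = (\<Sum>e\<in>E. \<tau> (star e * b) *\<^sub>C e))"
  using assms
proof (induction B)
  case empty
  show ?case by (rule exI[of _ "{}"]) simp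
next
  case (insert b B)
  then obtain E where E: "finite E" "\<And>e f. e \<in> E \<Longrightarrow> f \<in> E \<Longrightarrow> \<tau> (star e * f) = of_bool (e = f)"
    "\<And>b. b \<in> B \<Longrightarrow> b = (\<Sum>e\<in>E. \<tau> (star e * b) *\<^sub>C e)"
    by blast
  define b' where "b' = b - (\<Sum>e\<in>E. \<tau> (star e * b) *\<^sub>C e)"
  show ?case
  proof (cases "b' = 0")
    case True
    then show ?thesis using E by (intro exI[of _ E]) (auto simp: b'_def)
  next
    case False
    define r where "r = Re (\<tau> (star b' * b'))"
    have r: "r > 0" "\<tau> (star b' * b') = of_real r"
      using Re_trace_pos[OF False] Im_trace_square[of b'] by (auto simp: r_def complex_eq_iff)
    define n where "n = (1 / sqrt r) *\<^sub>R b'"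
    have orth: "\<tau> (star e * b') = 0" if "e \<in> E" for e
    proof -
      have "\<tau> (star e * b') = \<tau> (star e * b) - (\<Sum>f\<in>E. \<tau> (star f * b) * \<tau> (star e * f))"
        by (simp add: b'_def right_diff_distrib trace_diff sum_distrib_left mult_scaleC_right
            trace_sum trace_scaleC)
      also have "(\<Sum>f\<in>E. \<tau> (star f * b) * \<tau> (star e * f)) = (\<Sum>f\<in>E. \<tau> (star f * b) * of_bool (e = f))"
        using E(2) that by (intro sum.cong) auto
      also have "\<dots> = \<tau> (star e * b)"
        using E(1) that by (simp add: of_bool_def sum.delta if_distrib cong: if_cong)
      finally show ?thesis by simp
    qed
    have orth_n: "\<tau> (star e * n) = 0" "\<tau> (star n * e) = 0" if "e \<in> E" for e
    proof -
      show "\<tau> (star e * n) = 0" using orth[OF that] by (simp add: n_def trace_scaleR)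
      then show "\<tau> (star n * e) = 0" using trace_star[of "star e * n"] by (simp add: star_mult star_star)
    qed
    have "of_real r / (of_real (sqrt r) * of_real (sqrt r)) = (1::complex)"
      using r(1) by (simp add: of_real_mult[symmetric])
    then have nn: "\<tau> (star n * n) = 1"
      using r by (simp add: n_def star_scaleR trace_scaleR)
    have nb': "\<tau> (star n * b') = of_real (sqrt r)"
    proof -
      have "1 / sqrt r * r = sqrt r" using r(1) by (simp add: real_div_sqrt)
      then have "of_real (1 / sqrt r) * of_real r = (of_real (sqrt r) :: complex)"
        by (simp only: of_real_mult[symmetric])
      with r(2) show ?thesis by (simp add: n_def star_scaleR trace_scaleR)
    qed
    have "n \<notin> E" using orth_n(1)[of n] nn by auto
    have span_orth: "\<tau> (star n * (\<Sum>e\<in>E. c e *\<^sub>C e)) = 0" for c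
      by (simp add: sum_distrib_left mult_scaleC_right trace_sum trace_scaleC orth_n)
    show ?thesis
    proof (intro exI[of _ "insert n E"] conjI ballI)
      show "finite (insert n E)" using E(1) by simp
      show "\<tau> (star e * f) = of_bool (e = f)" if "e \<in> insert n E" "f \<in> insert n E" for e f
        using that E(2) orth_n nn \<open>n \<notin> E\<close> by auto
      fix c assume "c \<in> insert b B"
      then consider "c = b" | "c \<in> B" by blast
      then have "\<tau> (star n * c) *\<^sub>C n = c - (\<Sum>e\<in>E. \<tau> (star e * c) *\<^sub>C e)"
      proof cases
        case 1
        have "\<tau> (star n * b) = \<tau> (star n * (b' + (\<Sum>e\<in>E. \<tau> (star e * b) *\<^sub>C e)))"
          by (simp add: b'_def)
        also have "\<dots> = of_real (sqrt r)"
          by (simp only: distrib_left trace_add span_orth nb' add_0_right)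
        finally have "\<tau> (star n * b) *\<^sub>C n = b'"
          using r(1) by (simp add: scaleC_of_real n_def)
        with 1 show ?thesis by (simp add: b'_def)
      next
        case 2
        have "\<tau> (star n * c) = 0" by (subst E(3)[OF 2]) (rule span_orth)
        with E(3)[OF 2] show ?thesis by simp
      qed
      then show "c = (\<Sum>e\<in>insert n E. \<tau> (star e * c) *\<^sub>C e)"
        using E(1) \<open>n \<notin> E\<close> by simp
    qed
  qed
qed

lemma orthonormal_basis_exists: obtains E where "orthonormal_basis E"
proof -
  obtain B :: "'a set" where B: "finite B" "\<And>x. \<exists>c. x = (\<Sum>b\<in>B. c b *\<^sub>C b)"
    using finite_spanning_set by blast
  obtain E where E: "finite E" "\<forall>e\<in>E. \<forall>f\<in>E. \<tau> (star e * f) = of_bool (e = f)"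
    "\<And>b. b \<in> B \<Longrightarrow> b = (\<Sum>e\<in>E. \<tau> (star e * b) *\<^sub>C e)"
    using gram_schmidt[OF B(1)] by blast
  have "x = (\<Sum>e\<in>E. \<tau> (star e * x) *\<^sub>C e)" for x
  proof -
    obtain c where c: "x = (\<Sum>b\<in>B. c b *\<^sub>C b)" using B(2) by blast
    also have "\<dots> = (\<Sum>b\<in>B. c b *\<^sub>C (\<Sum>e\<in>E. \<tau> (star e * b) *\<^sub>C e))"
      using E(3) by (intro sum.cong) auto
    also have "\<dots> = (\<Sum>e\<in>E. \<Sum>b\<in>B. (c b * \<tau> (star e * b)) *\<^sub>C e)"
      by (simp only: scaleC_sum_right scaleC_scaleC) (rule sum.swap)
    also have "\<dots> = (\<Sum>e\<in>E. (\<Sum>b\<in>B. c b * \<tau> (star e * b)) *\<^sub>C e)"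
    proof (intro sum.cong refl)
      have "(\<Sum>b\<in>B. k b) *\<^sub>C e = (\<Sum>b\<in>B. k b *\<^sub>C e)" for k and e :: 'a
        using B(1) by (induction B) (simp_all add: scaleC_add_left)
      then show "(\<Sum>b\<in>B. (c b * \<tau> (star e * b)) *\<^sub>C e) = (\<Sum>b\<in>B. c b * \<tau> (star e * b)) *\<^sub>C e" for e
        by simp
    qed
    also have "\<dots> = (\<Sum>e\<in>E. \<tau> (star e * x) *\<^sub>C e)"
      by (simp add: c sum_distrib_left mult_scaleC_right trace_sum trace_scaleC)
    finally show ?thesis .
  qed
  with E that show thesis unfolding orthonormal_basis_def by blast
qed

text \<open>All norms on a finite-dimensional space are equivalent: on the compact set of coefficient
  vectors whose largest entry has modulus one, the norm of the linear combination attains a positive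
  minimum.\<close>

lemma orthonormal_coefficient_bound:
  assumes E: "orthonormal_basis E"
  shows "\<exists>C. \<forall>e\<in>E. \<forall>x. cmod (\<tau> (star e * x)) \<le> C * norm x"
proof -
  have fin: "finite E" and on: "\<And>e f. e \<in> E \<Longrightarrow> f \<in> E \<Longrightarrow> \<tau> (star e * f) = of_bool (e = f)"
    and ex: "\<And>x. x = (\<Sum>e\<in>E. \<tau> (star e * x) *\<^sub>C e)"
    using E unfolding orthonormal_basis_def by blast+
  define T :: "'a \<Rightarrow> ('a \<Rightarrow> complex) set" where
    "T = (\<lambda>e1. PiE UNIV (\<lambda>e. if e = e1 then sphere 0 1 else if e \<in> E then cball 0 1 else {0}))"
  have "\<exists>m>0. \<forall>c\<in>T e1. m \<le> norm (\<Sum>e\<in>E. c e *\<^sub>C e)" if e1: "e1 \<in> E" for e1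
  proof -
    have compact: "compact (T e1)"
      unfolding T_def compactin_euclidean_iff[symmetric] euclidean_product_topology[symmetric]
        compactin_PiE by auto
    have "(\<lambda>e. if e = e1 then 1 else 0) \<in> T e1"
      by (auto simp: T_def)
    then have nonempty: "T e1 \<noteq> {}" by blast
    have "continuous_on (T e1) (\<lambda>c. norm (\<Sum>e\<in>E. c e *\<^sub>C e))"
    proof (intro continuous_intros)
      show "continuous_on (T e1) (\<lambda>c. c e *\<^sub>C e)" for e
        by (rule bounded_linear.continuous_on[OF bounded_linear_scaleC_left])
          (rule continuous_on_subset[OF continuous_on_product_coordinates], simp)
    qed
    from continuous_attains_inf[OF compact nonempty this]
    obtain c0 where c0: "c0 \<in> T e1"
      "\<forall>c\<in>T e1. norm (\<Sum>e\<in>E. c0 e *\<^sub>C e) \<le> norm (\<Sum>e\<in>E. c e *\<^sub>C e)" ..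
    have "\<tau> (star e1 * (\<Sum>e\<in>E. c0 e *\<^sub>C e)) = (\<Sum>e\<in>E. c0 e * \<tau> (star e1 * e))"
      by (simp add: sum_distrib_left mult_scaleC_right trace_sum trace_scaleC)
    also have "\<dots> = (\<Sum>e\<in>E. c0 e * of_bool (e1 = e))"
      using on e1 by (intro sum.cong) auto
    also have "\<dots> = c0 e1"
      using fin e1 by (simp add: of_bool_def sum.delta if_distrib cong: if_cong)
    finally have "\<tau> (star e1 * (\<Sum>e\<in>E. c0 e *\<^sub>C e)) = c0 e1" .
    moreover have "cmod (c0 e1) = 1"
      using c0(1) by (auto simp: T_def PiE_iff split: if_splits dest!: spec[of _ e1])
    ultimately have "(\<Sum>e\<in>E. c0 e *\<^sub>C e) \<noteq> 0" by auto
    with c0 show ?thesis by (intro exI[of _ "norm (\<Sum>e\<in>E. c0 e *\<^sub>C e)"]) simp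
  qed
  then obtain m where m: "\<And>e1. e1 \<in> E \<Longrightarrow> m e1 > 0"
    "\<And>e1 c. e1 \<in> E \<Longrightarrow> c \<in> T e1 \<Longrightarrow> m e1 \<le> norm (\<Sum>e\<in>E. c e *\<^sub>C e)"
    by metis
  have "cmod (\<tau> (star e0 * x)) \<le> (\<Sum>e\<in>E. 1 / m e) * norm x" if e0: "e0 \<in> E" for e0 x
  proof -
    have "\<exists>e1\<in>E. \<forall>e\<in>E. cmod (\<tau> (star e * x)) \<le> cmod (\<tau> (star e1 * x))"
    proof -
      have "Max ((\<lambda>e. cmod (\<tau> (star e * x))) ` E) \<in> (\<lambda>e. cmod (\<tau> (star e * x))) ` E"
        using fin e0 by (intro Max_in) auto
      then obtain e1 where "e1 \<in> E" "Max ((\<lambda>e. cmod (\<tau> (star e * x))) ` E) = cmod (\<tau> (star e1 * x))"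
        by blast
      moreover have "cmod (\<tau> (star e * x)) \<le> Max ((\<lambda>e. cmod (\<tau> (star e * x))) ` E)" if "e \<in> E" for e
        using fin that by (intro Max_ge) auto
      ultimately show ?thesis by auto
    qed
    then obtain e1 where e1: "e1 \<in> E" "\<And>e. e \<in> E \<Longrightarrow> cmod (\<tau> (star e * x)) \<le> cmod (\<tau> (star e1 * x))"
      by blast
    let ?M = "cmod (\<tau> (star e1 * x))"
    have "?M * m e1 \<le> norm x"
    proof (cases "?M = 0")
      case False
      define c where "c = (\<lambda>e. if e \<in> E then of_real (1 / ?M) * \<tau> (star e * x) else 0)"
      have "c \<in> T e1"
        using e1 False by (auto simp: T_def c_def norm_mult norm_divide divide_le_eq)
      then have "m e1 \<le> norm (\<Sum>e\<in>E. c e *\<^sub>C e)" using m(2) e1(1) by blast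
      also have "(\<Sum>e\<in>E. c e *\<^sub>C e) = of_real (1 / ?M) *\<^sub>C (\<Sum>e\<in>E. \<tau> (star e * x) *\<^sub>C e)"
        by (simp add: c_def scaleC_sum_right scaleC_scaleC)
      also have "\<dots> = of_real (1 / ?M) *\<^sub>C x" using ex[of x] by simp
      finally show ?thesis using False by (simp add: norm_scaleC norm_divide field_simps)
    qed simp
    then have "?M \<le> 1 / m e1 * norm x" using m(1)[OF e1(1)] by (simp add: field_simps)
    also have "\<dots> \<le> (\<Sum>e\<in>E. 1 / m e) * norm x"
      using m(1) fin e1(1) by (intro mult_right_mono member_le_sum) (auto simp: less_imp_le)
    finally show ?thesis using e1(2)[OF e0] by linarith
  qed
  then show ?thesis by blast
qed

lemma bounded_linear_trace: "bounded_linear \<tau>"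
proof -
  obtain E where E: "orthonormal_basis E" by (rule orthonormal_basis_exists)
  obtain C where C: "\<forall>e\<in>E. \<forall>x. cmod (\<tau> (star e * x)) \<le> C * norm x"
    using orthonormal_coefficient_bound[OF E] ..
  have "cmod (\<tau> x) \<le> norm x * (\<Sum>e\<in>E. C * cmod (\<tau> e))" for x
  proof -
    have "x = (\<Sum>e\<in>E. \<tau> (star e * x) *\<^sub>C e)" using E unfolding orthonormal_basis_def by blast
    then have "\<tau> x = \<tau> (\<Sum>e\<in>E. \<tau> (star e * x) *\<^sub>C e)" by (rule arg_cong)
    then have "\<tau> x = (\<Sum>e\<in>E. \<tau> (star e * x) * \<tau> e)" by (simp add: trace_sum trace_scaleC)
    then have "cmod (\<tau> x) = cmod (\<Sum>e\<in>E. \<tau> (star e * x) * \<tau> e)" by (rule arg_cong)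
    also have "\<dots> \<le> (\<Sum>e\<in>E. cmod (\<tau> (star e * x)) * cmod (\<tau> e))"
      by (rule order_trans[OF norm_sum]) (simp add: norm_mult)
    also have "\<dots> \<le> (\<Sum>e\<in>E. (C * norm x) * cmod (\<tau> e))"
      using C by (intro sum_mono mult_right_mono) auto
    finally show ?thesis by (simp add: sum_distrib_left mult_ac)
  qed
  then show ?thesis
    by (intro bounded_linear_intro) (simp_all add: trace_add trace_scaleR scaleR_conv_of_real[where 'a = complex])
qed

lemmas tendsto_trace = bounded_linear.tendsto[OF bounded_linear_trace]

lemma complex_linear_op_expansion:
  assumes E: "orthonormal_basis E" and T: "complex_linear_op T"
  shows "T x = (\<Sum>e\<in>E. \<tau> (star e * x) *\<^sub>C T e)"
proof -
  have "x = (\<Sum>e\<in>E. \<tau> (star e * x) *\<^sub>C e)" using E unfolding orthonormal_basis_def by blast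
  then have "T x = T (\<Sum>e\<in>E. \<tau> (star e * x) *\<^sub>C e)" by (rule arg_cong)
  then show ?thesis by (simp add: complex_linear_op_sum[OF T])
qed

text \<open>The constant does not depend on the operator, so a family of operators is bounded as soon as it
  is bounded at each of the finitely many basis vectors.\<close>

lemma complex_linear_op_bound:
  assumes E: "orthonormal_basis E"
  shows "\<exists>C\<ge>0. \<forall>(T :: 'a \<Rightarrow> 'a) x. complex_linear_op T \<longrightarrow>
    norm (T x) \<le> C * norm x * (\<Sum>e\<in>E. norm (T e))"
proof -
  obtain C where C: "\<forall>e\<in>E. \<forall>x. cmod (\<tau> (star e * x)) \<le> C * norm x"
    using orthonormal_coefficient_bound[OF E] ..
  have "norm (T x) \<le> \<bar>C\<bar> * norm x * (\<Sum>e\<in>E. norm (T e))" if T: "complex_linear_op T" for T :: "'a \<Rightarrow> 'a" and x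
  proof -
    have "norm (T x) \<le> (\<Sum>e\<in>E. cmod (\<tau> (star e * x)) * norm (T e))"
      unfolding complex_linear_op_expansion[OF E T, of x]
      by (rule order_trans[OF norm_sum]) (simp add: norm_scaleC)
    also have "\<dots> \<le> (\<Sum>e\<in>E. (\<bar>C\<bar> * norm x) * norm (T e))"
      using C by (intro sum_mono mult_right_mono) (auto intro: order_trans[OF _ mult_right_mono[OF abs_ge_self]])
    finally show ?thesis by (simp add: sum_distrib_left)
  qed
  then show ?thesis by (intro exI[of _ "\<bar>C\<bar>"]) auto
qed

lemma bounded_linear_complex_linear_op:
  fixes T :: "'a \<Rightarrow> 'a"
  assumes T: "complex_linear_op T"
  shows "bounded_linear T"
proof -
  obtain E where E: "orthonormal_basis E" by (rule orthonormal_basis_exists)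
  obtain C where "C \<ge> 0" and C: "\<forall>(T :: 'a \<Rightarrow> 'a) x. complex_linear_op T \<longrightarrow>
      norm (T x) \<le> C * norm x * (\<Sum>e\<in>E. norm (T e))"
    using complex_linear_op_bound[OF E] by (elim exE conjE)
  from C[rule_format, OF T] have "norm (T x) \<le> norm x * (C * (\<Sum>e\<in>E. norm (T e)))" for x by (simp add: mult_ac)
  then show ?thesis
    using T by (intro bounded_linear_intro) (auto simp: complex_linear_op_def scaleC_of_real[symmetric])
qed

text \<open>The description in the definition of \<open>tr_adjoint\<close> denotes: an adjoint is given explicitly in an
  orthonormal basis, and it is unique because the trace is faithful.\<close>

lemma tr_adjoint_property:
  assumes T: "complex_linear_op T"
  shows "\<tau> (star (T a) * b) = \<tau> (star a * tr_adjoint \<tau> T b)"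
proof -
  obtain E where E: "orthonormal_basis E" by (rule orthonormal_basis_exists)
  define S where "S = (\<lambda>b. \<Sum>e\<in>E. \<tau> (star (T e) * b) *\<^sub>C e)"
  have S: "\<tau> (star (T a) * b) = \<tau> (star a * S b)" for a b
  proof -
    have "\<tau> (star (T a) * b) = \<tau> (star (\<Sum>e\<in>E. \<tau> (star e * a) *\<^sub>C T e) * b)"
      using complex_linear_op_expansion[OF E T, of a] by simp
    also have "\<dots> = (\<Sum>e\<in>E. cnj (\<tau> (star e * a)) * \<tau> (star (T e) * b))"
      by (simp add: star_sum star_scaleC sum_distrib_right mult_scaleC_left trace_sum trace_scaleC)
    also have "\<dots> = (\<Sum>e\<in>E. \<tau> (star (T e) * b) * \<tau> (star a * e))"
      by (simp add: trace_star[symmetric] star_mult star_star mult.commute)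
    also have "\<dots> = \<tau> (star a * S b)"
      by (simp add: S_def sum_distrib_left mult_scaleC_right trace_sum trace_scaleC)
    finally show ?thesis .
  qed
  have "tr_adjoint \<tau> T = S"
    unfolding tr_adjoint_def
  proof (rule the_equality)
    show "\<forall>a b. \<tau> (star (T a) * b) = \<tau> (star a * S b)" using S by blast
    fix R assume "\<forall>a b. \<tau> (star (T a) * b) = \<tau> (star a * R b)"
    then have "\<tau> (star (star a) * R b) = \<tau> (star (star a) * S b)" for a b by (simp only: S[symmetric])
    then show "R = S" by (intro ext trace_mult_eqI) (simp add: star_star)
  qed
  with S show ?thesis by simp
qed

end

section \<open>Spectral decomposition and the logarithm\<close>

text \<open>Whereas \<open>poly\<close> takes its argument in the coefficient ring, complex polynomials are here evaluated
  at elements of the algebra, by Horner's scheme.\<close>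

definition poly_at :: "complex poly \<Rightarrow> 'a::cstar_algebra \<Rightarrow> 'a" where
  "poly_at p a = fold_coeffs (\<lambda>c y. c *\<^sub>C 1 + a * y) p 0"

lemma poly_at_0 [simp]: "poly_at 0 a = 0"
  by (simp add: poly_at_def)

lemma poly_at_pCons [simp]: "poly_at (pCons c p) a = c *\<^sub>C 1 + a * poly_at p a"
  by (cases "p = 0 \<and> c = 0") (auto simp: poly_at_def)

lemma poly_at_add: "poly_at (p + q) a = poly_at p a + poly_at q a"
  by (induction p q rule: poly_induct2) (simp_all add: scaleC_add_left algebra_simps)

lemma poly_at_smult: "poly_at (smult c p) a = c *\<^sub>C poly_at p a"
  by (induction p) (simp_all add: scaleC_add_right scaleC_scaleC mult_scaleC_right)

lemma poly_at_mult: "poly_at (p * q) a = poly_at p a * poly_at q a"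
  by (induction p) (simp_all add: poly_at_add poly_at_smult distrib_right mult_scaleC_left mult.assoc)

lemma poly_at_monom: "poly_at (monom c n) a = c *\<^sub>C a ^ n"
  by (induction n) (simp_all add: monom_0 monom_Suc mult_scaleC_right)

lemma poly_at_sum: "poly_at (\<Sum>i\<in>I. p i) a = (\<Sum>i\<in>I. poly_at (p i) a)"
  by (induction I rule: infinite_finite_induct) (simp_all add: poly_at_add)

lemma poly_at_eigenvector:
  assumes "a * y = l *\<^sub>C y"
  shows "poly_at p a * y = poly p l *\<^sub>C y"
  by (induction p)
    (simp_all add: distrib_right mult_scaleC_left mult.assoc mult_scaleC_right assms
      scaleC_scaleC scaleC_add_left mult.commute)

text \<open>This identifies the exponential of \<open>\<Sum>\<^sub>\<lambda> ln \<lambda> P\<^sub>\<lambda>\<close> below, one spectral projection at a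
  time.\<close>

lemma exp_eigenvector:
  fixes h y :: "'a::{real_normed_algebra_1,banach}"
  assumes "h * y = r *\<^sub>R y"
  shows "exp h * y = exp r *\<^sub>R y"
proof (rule sums_unique2)
  have "h ^ n * y = r ^ n *\<^sub>R y" for n
    by (induction n) (simp_all add: mult.assoc assms)
  moreover have "(\<lambda>n. h ^ n /\<^sub>R fact n * y) sums (exp h * y)"
    by (intro sums_mult2 exp_converges)
  ultimately show "(\<lambda>n. (r ^ n /\<^sub>R fact n) *\<^sub>R y) sums (exp h * y)"
    by simp
  show "(\<lambda>n. (r ^ n /\<^sub>R fact n) *\<^sub>R y) sums (exp r *\<^sub>R y)"
    by (intro bounded_linear.sums[OF bounded_linear_scaleR_left] exp_converges)
qed

context faithful_trace_functional
begin

text \<open>In a finite-dimensional algebra the powers of \<open>a\<close> are linearly dependent.\<close>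

lemma annihilating_poly_exists:
  fixes a :: 'a
  obtains p where "p \<noteq> 0" "poly_at p a = 0"
proof (cases "inj (\<lambda>n. a ^ n)")
  case False
  then obtain i j where ij: "i \<noteq> j" "a ^ i = a ^ j" by (auto simp: inj_def)
  show thesis
  proof (rule that)
    show "monom 1 i - monom 1 j \<noteq> (0 :: complex poly)"
      using ij(1) by (auto simp: poly_eq_iff)
    show "poly_at (monom 1 i - monom 1 j) a = 0"
      using ij(2) poly_at_add[of "monom 1 i - monom 1 j" "monom 1 j" a] by (simp add: poly_at_monom)
  qed
next
  case True
  obtain E where E: "orthonormal_basis E" by (rule orthonormal_basis_exists)
  then have fin: "finite E" by (simp add: orthonormal_basis_def)
  let ?B = "E \<union> (\<lambda>e. \<i> *\<^sub>C e) ` E"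
  have "x \<in> span ?B" for x
  proof -
    have eq: "c *\<^sub>C e = Re c *\<^sub>R e + Im c *\<^sub>R \<i> *\<^sub>C e" for c and e :: 'a
      unfolding scaleC_of_real[symmetric] scaleC_scaleC scaleC_add_left[symmetric]
      by (simp add: complex_eq[symmetric] mult.commute[of _ \<i>])
    have "(\<Sum>e\<in>E. \<tau> (star e * x) *\<^sub>C e) \<in> span ?B"
    proof (rule span_sum)
      fix e assume "e \<in> E"
      then have "Re c *\<^sub>R e + Im c *\<^sub>R \<i> *\<^sub>C e \<in> span ?B" for c
        by (intro span_add span_scale span_base) auto
      then show "\<tau> (star e * x) *\<^sub>C e \<in> span ?B" by (simp only: eq[symmetric])
    qed
    moreover have "x = (\<Sum>e\<in>E. \<tau> (star e * x) *\<^sub>C e)"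
      using E unfolding orthonormal_basis_def by blast
    ultimately show ?thesis by simp
  qed
  moreover have "finite ?B" using fin by simp
  moreover have "infinite (range (\<lambda>n. a ^ n))" using True by (rule range_inj_infinite)
  ultimately have "dependent (range (\<lambda>n. a ^ n))"
    using independent_span_bound[of ?B "range (\<lambda>n. a ^ n)"] by blast
  then obtain t u v where t: "finite t" "t \<subseteq> range (\<lambda>n. a ^ n)" "(\<Sum>v\<in>t. u v *\<^sub>R v) = 0"
    and v: "v \<in> t" "u v \<noteq> 0"
    unfolding dependent_explicit by blast
  from finite_subset_image[OF t(1,2)] obtain N where N: "finite N" "t = (\<lambda>n. a ^ n) ` N" by blast
  have inj: "inj_on (\<lambda>n. a ^ n) N" using True by (rule inj_on_subset) simp
  from v(1) N obtain m where m: "m \<in> N" "v = a ^ m" by blast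
  let ?p = "\<Sum>n\<in>N. monom (complex_of_real (u (a ^ n))) n"
  show thesis
  proof (rule that)
    have "coeff ?p m = of_real (u (a ^ m))"
      using N(1) m(1) by (simp add: coeff_sum sum.delta)
    with v(2) m(2) show "?p \<noteq> 0" by auto
    have "poly_at ?p a = (\<Sum>n\<in>N. u (a ^ n) *\<^sub>R a ^ n)"
      by (simp add: poly_at_sum poly_at_monom scaleC_of_real)
    also have "\<dots> = 0" using t(3) unfolding N(2) by (simp add: sum.reindex[OF inj])
    finally show "poly_at ?p a = 0" .
  qed
qed

lemma selfadjoint_eigenvalue_real:
  fixes a :: 'a
  assumes a: "selfadjoint a" and y: "a * y = l *\<^sub>C y" "y \<noteq> 0"
  shows "Im l = 0"
proof -
  have "\<tau> (star y * (a * y)) = l * \<tau> (star y * y)"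
    by (simp add: y(1) mult_scaleC_right trace_scaleC)
  moreover have "selfadjoint (star y * (a * y))"
    using a by (simp add: selfadjoint_def star_mult star_star mult.assoc)
  then have "Im (\<tau> (star y * (a * y))) = 0" by (rule trace_selfadjoint_real)
  ultimately show ?thesis using Re_trace_pos[OF y(2)] Im_trace_square[of y] by simp
qed

text \<open>Left multiplication by a self-adjoint element has no nontrivial Jordan blocks: if
  \<open>(a - l) w \<noteq> 0\<close>, it is an eigenvector, so \<open>l\<close> is real and \<open>n = a - l\<close> is self-adjoint; then
  \<open>\<tau>((n w)\<^sup>* (n w)) = \<tau>(w\<^sup>* n\<^sup>2 w) = 0\<close>.\<close>

lemma selfadjoint_no_jordan_block:
  fixes a :: 'a
  assumes a: "selfadjoint a" and w: "(a - l *\<^sub>C 1) * ((a - l *\<^sub>C 1) * w) = 0"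
  shows "(a - l *\<^sub>C 1) * w = 0"
proof (rule ccontr)
  let ?n = "a - l *\<^sub>C 1"
  assume nz: "?n * w \<noteq> 0"
  have "a * (?n * w) = l *\<^sub>C (?n * w)"
    using w by (simp only: left_diff_distrib mult_scaleC_left mult_1_left right_minus_eq)
  then have "Im l = 0" using a nz by (intro selfadjoint_eigenvalue_real)
  then have "cnj l = l" by (simp add: complex_eq_iff)
  then have "star ?n = ?n"
    using a by (simp add: star_diff star_scaleC selfadjoint_def)
  then have "star (?n * w) * (?n * w) = star w * (?n * (?n * w))"
    by (simp add: star_mult mult.assoc)
  with w have "\<tau> (star (?n * w) * (?n * w)) = 0" by simp
  with nz show False using trace_faithful by blast
qed

text \<open>Split off one root \<open>l\<close> of \<open>p = (z - l) q\<close> at a time.  If \<open>q(l) \<noteq> 0\<close>, subtracting a multiple of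
  the eigenvector \<open>q(a) x\<close> from \<open>x\<close> leaves a vector annihilated by \<open>q(a)\<close>; if \<open>l\<close> is a multiple
  root, \<open>q(a)\<close> already annihilates \<open>x\<close>.\<close>

lemma eigenvector_decomposition_of_annihilated:
  fixes a :: 'a
  assumes a: "selfadjoint a"
  shows "p \<noteq> 0 \<Longrightarrow> poly_at p a * x = 0 \<Longrightarrow>
    \<exists>S f. finite S \<and> x = (\<Sum>l\<in>S. f l) \<and> (\<forall>l\<in>S. a * f l = l *\<^sub>C f l)"
proof (induction "degree p" arbitrary: p x rule: less_induct)
  case less
  show ?case
  proof (cases "degree p = 0")
    case True
    then obtain c where "p = [:c:]" by (rule degree_eq_zeroE)
    with less.prems have "c \<noteq> 0" "c *\<^sub>C x = 0" by (auto simp: mult_scaleC_left)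
    then have "inverse c *\<^sub>C c *\<^sub>C x = 0" by simp
    with \<open>c \<noteq> 0\<close> have "x = 0" by (simp add: scaleC_scaleC)
    then show ?thesis by (intro exI[of _ "{}"]) simp
  next
    case False
    then obtain l where "poly p l = 0"
      using fundamental_theorem_of_algebra[of p] by (auto simp: constant_degree)
    then obtain q where p: "p = [:- l, 1:] * q" by (auto simp: poly_eq_0_iff_dvd)
    with less.prems(1) have q: "q \<noteq> 0" by auto
    then have deg: "degree q < degree p" unfolding p by (subst degree_mult_eq) auto
    have factor: "poly_at ([:- l, 1:] * r) a = (a - l *\<^sub>C 1) * poly_at r a" for r
      by (subst poly_at_mult) (simp add: scaleC_minus_left)
    define y where "y = poly_at q a * x"
    have "(a - l *\<^sub>C 1) * y = 0"
      using less.prems(2) unfolding p factor y_def by (simp add: mult.assoc)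
    then have y: "a * y = l *\<^sub>C y" by (simp add: left_diff_distrib mult_scaleC_left)
    show ?thesis
    proof (cases "poly q l = 0")
      case True
      then obtain r where r: "q = [:- l, 1:] * r" by (auto simp: poly_eq_0_iff_dvd)
      have "(a - l *\<^sub>C 1) * ((a - l *\<^sub>C 1) * (poly_at r a * x)) = 0"
        using less.prems(2) unfolding p r factor by (simp add: mult.assoc)
      then have "poly_at q a * x = 0"
        unfolding r factor using selfadjoint_no_jordan_block[OF a] by (simp add: mult.assoc)
      with less.hyps[OF deg q] show ?thesis .
    next
      case False
      define z where "z = (1 / poly q l) *\<^sub>C y"
      have z: "a * z = l *\<^sub>C z"
        by (simp add: z_def y mult_scaleC_right scaleC_scaleC mult.commute)
      have "poly_at q a * z = y"
        using False unfolding poly_at_eigenvector[OF z] by (simp add: z_def scaleC_scaleC)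
      then have "poly_at q a * (x - z) = 0" by (simp add: right_diff_distrib y_def)
      from less.hyps[OF deg q this] obtain S f where
        S: "finite S" "x - z = (\<Sum>l\<in>S. f l)" "\<And>m. m \<in> S \<Longrightarrow> a * f m = m *\<^sub>C f m"
        by blast
      define g where "g m = (if m \<in> S then f m else 0) + (if m = l then z else 0)" for m
      have "(\<Sum>m\<in>insert l S. g m) = (\<Sum>m\<in>insert l S. if m \<in> S then f m else 0) + z"
        using S(1) by (simp add: g_def sum.distrib sum.delta)
      also have "(\<Sum>m\<in>insert l S. if m \<in> S then f m else 0) = (\<Sum>m\<in>S. f m)"
        using S(1) by (intro sum.mono_neutral_cong_right) auto
      finally have "x = (\<Sum>m\<in>insert l S. g m)" using S(2) by (simp add: algebra_simps)
      moreover have "a * g m = m *\<^sub>C g m" for m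
        using S(3) z by (simp add: g_def distrib_left scaleC_add_right)
      ultimately show ?thesis using S(1) by (intro exI[of _ "insert l S"] exI[of _ g]) simp
    qed
  qed
qed

text \<open>Decomposing the unit into left eigenvectors of \<open>a\<close> yields the spectral projections of \<open>a\<close>
  themselves: eigenvectors of distinct real eigenvalues are orthogonal, so multiplying
  \<open>1 = \<Sum>\<^sub>\<lambda> P\<^sub>\<lambda>\<close> from the left by \<open>P\<^sub>\<mu>\<^sup>*\<close> gives \<open>P\<^sub>\<mu>\<^sup>* = P\<^sub>\<mu>\<^sup>* P\<^sub>\<mu>\<close>.  The logarithm
  is \<open>\<Sum>\<^sub>\<lambda> ln \<lambda> P\<^sub>\<lambda>\<close>.\<close>

lemma selfadjoint_logarithm_exists:
  fixes a :: 'a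
  assumes "positive_definite a"
  obtains h where "selfadjoint h" "exp h = a"
proof -
  obtain b c where b: "a = star b * b" and c: "c * a = 1"
    using assms unfolding positive_definite_def by blast
  have a: "selfadjoint a" by (simp add: selfadjoint_def b star_mult star_star)
  obtain p where p: "p \<noteq> 0" "poly_at p a = 0" by (rule annihilating_poly_exists[of a])
  then have "poly_at p a * 1 = 0" by simp
  from eigenvector_decomposition_of_annihilated[OF a p(1) this] obtain S P where
    S: "finite S" and one: "1 = (\<Sum>l\<in>S. P l)" and P: "\<And>l. l \<in> S \<Longrightarrow> a * P l = l *\<^sub>C P l"
    by blast
  have pos: "0 < Re l" "l = of_real (Re l)" if "l \<in> S" "P l \<noteq> 0" for l
  proof -
    have "b * P l \<noteq> 0"
    proof
      assume "b * P l = 0"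
      then have "c * (star b * (b * P l)) = 0" by simp
      then have "(c * a) * P l = 0" by (simp only: b mult.assoc)
      with c that show False by simp
    qed
    then have "0 < Re (\<tau> (star (b * P l) * (b * P l)))" by (rule Re_trace_pos)
    also have "star (b * P l) * (b * P l) = star (P l) * (a * P l)"
      by (simp add: b star_mult mult.assoc)
    also have "\<dots> = l *\<^sub>C (star (P l) * P l)" using P[OF that(1)] by (simp add: mult_scaleC_right)
    finally have "0 < Re (l * \<tau> (star (P l) * P l))" by (simp add: trace_scaleC)
    moreover have Im: "Im l = 0" using P[OF that(1)] that(2) by (intro selfadjoint_eigenvalue_real[OF a])
    ultimately show "0 < Re l"
      using Re_trace_pos[OF that(2)] by (simp add: zero_less_mult_iff)
    show "l = of_real (Re l)" using Im by (simp add: complex_eq_iff)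
  qed
  have orth: "star (P m) * P l = 0" if "l \<in> S" "m \<in> S" "l \<noteq> m" for l m
  proof (cases "P m = 0")
    case False
    have "Im m = Im (of_real (Re m))" by (rule arg_cong[OF pos(2)[OF that(2) False]])
    then have m: "cnj m = m" by (simp add: complex_eq_iff)
    have "l *\<^sub>C (star (P m) * P l) = star (P m) * (a * P l)"
      using P[OF that(1)] by (simp add: mult_scaleC_right)
    also have "\<dots> = star (a * P m) * P l"
      using a by (simp add: star_mult mult.assoc selfadjoint_def)
    also have "\<dots> = m *\<^sub>C (star (P m) * P l)"
      using P[OF that(2)] m by (simp add: star_scaleC mult_scaleC_left)
    finally have "(l - m) *\<^sub>C (star (P m) * P l) = 0" by (simp add: scaleC_diff_left)
    then have "(1 / (l - m)) *\<^sub>C (l - m) *\<^sub>C (star (P m) * P l) = 0" by simp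
    with that(3) show ?thesis by (simp only: scaleC_scaleC) simp
  qed simp
  have proj: "star (P m) = P m" "P m * P m = P m" if "m \<in> S" for m
  proof -
    have "star (P m) * 1 = star (P m) * (\<Sum>l\<in>S. P l)" by (rule arg_cong[OF one])
    then have "star (P m) = (\<Sum>l\<in>S. star (P m) * P l)" by (simp add: sum_distrib_left)
    also have "\<dots> = (\<Sum>l\<in>S. if l = m then star (P m) * P m else 0)"
      using orth that by (intro sum.cong) auto
    also have "\<dots> = star (P m) * P m" using S that by simp
    finally have eq: "star (P m) = star (P m) * P m" .
    from arg_cong[OF this, of star] have "P m = star (P m) * P m" by (simp add: star_mult star_star)
    with eq show "star (P m) = P m" by simp
    with eq show "P m * P m = P m" by simp
  qed
  define h where "h = (\<Sum>l\<in>S. ln (Re l) *\<^sub>R P l)"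
  have hP: "h * P m = ln (Re m) *\<^sub>R P m" if "m \<in> S" for m
  proof -
    have "h * P m = (\<Sum>l\<in>S. ln (Re l) *\<^sub>R (P l * P m))" by (simp add: h_def sum_distrib_right)
    also have "\<dots> = (\<Sum>l\<in>S. if l = m then ln (Re m) *\<^sub>R P m else 0)"
    proof (intro sum.cong refl)
      fix l assume "l \<in> S"
      with orth[OF that this] proj that
      show "ln (Re l) *\<^sub>R (P l * P m) = (if l = m then ln (Re m) *\<^sub>R P m else 0)" by auto
    qed
    finally show ?thesis using S that by simp
  qed
  have "exp h * P m = a * P m" if "m \<in> S" for m
  proof (cases "P m = 0")
    case False
    then have "exp h * P m = Re m *\<^sub>R P m"
      using exp_eigenvector[OF hP[OF that]] pos(1)[OF that] by simp
    also have "\<dots> = of_real (Re m) *\<^sub>C P m" by (rule scaleC_of_real[symmetric])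
    also have "\<dots> = m *\<^sub>C P m" by (rule arg_cong[OF pos(2)[OF that False, symmetric]])
    finally show ?thesis using P[OF that] by simp
  qed simp
  then have "exp h * (\<Sum>m\<in>S. P m) = a * (\<Sum>m\<in>S. P m)"
    unfolding sum_distrib_left by (intro sum.cong) auto
  then have "exp h = a" by (simp add: one[symmetric])
  moreover have "selfadjoint h"
    using proj(1) by (simp add: selfadjoint_def h_def star_sum star_scaleR)
  ultimately show thesis using that by blast
qed

text \<open>Halving both exponentials and moving one factor around the trace turns the expression on the left
  into \<open>\<tau>(y\<^sup>* y)\<close> when \<open>d\<close>, \<open>h\<close> and \<open>k\<close> are self-adjoint.\<close>

lemma trace_exp_conjugation:
  "\<tau> (d * (exp (s *\<^sub>R h) * d * exp ((1 - s) *\<^sub>R k))) =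
    \<tau> (exp (((1 - s) / 2) *\<^sub>R k) * d * exp ((s/2) *\<^sub>R h) * (exp ((s/2) *\<^sub>R h) * d * exp (((1 - s) / 2) *\<^sub>R k)))"
  unfolding exp_half_mult[of s h, symmetric] exp_half_mult[of "1 - s" k, symmetric]
  using trace_commute[of "exp (((1 - s) / 2) *\<^sub>R k)"
      "d * exp ((s/2) *\<^sub>R h) * (exp ((s/2) *\<^sub>R h) * d * exp (((1 - s) / 2) *\<^sub>R k))"]
  by (simp add: mult.assoc)

text \<open>If \<open>exp h = exp k\<close>, then \<open>s \<mapsto> \<tau>(d exp (sh) exp ((1 - s) k))\<close> with \<open>d = h - k\<close> takes the same
  value at \<open>0\<close> and \<open>1\<close>.  By Rolle's theorem its derivative vanishes somewhere; but the derivative is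
  \<open>\<tau>(y\<^sup>* y)\<close> for \<open>y = exp (sh/2) d exp ((1 - s) k/2)\<close>.\<close>

lemma exp_inj_selfadjoint:
  fixes h k :: 'a
  assumes h: "selfadjoint h" and k: "selfadjoint k" and eq: "exp h = exp k"
  shows "h = k"
proof -
  define d where "d = h - k"
  let ?f = "\<lambda>s. Re (\<tau> (d * (exp (s *\<^sub>R h) * exp ((1 - s) *\<^sub>R k))))"
  let ?f' = "\<lambda>s. Re (\<tau> (d * (exp (s *\<^sub>R h) * d * exp ((1 - s) *\<^sub>R k))))"
  have "bounded_linear (\<lambda>x. Re (\<tau> (d * x)))"
    by (intro bounded_linear_compose[OF bounded_linear_Re] bounded_linear_compose[OF bounded_linear_trace]
        bounded_linear_mult_right)
  from bounded_linear.has_vector_derivative[OF this exp_interpolation_derivative[of h k]]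
  have "(?f has_real_derivative ?f' s) (at s)" for s
    by (simp add: d_def has_real_derivative_iff_has_vector_derivative)
  then obtain s where "?f 1 - ?f 0 = (1 - 0) * ?f' s"
    using MVT2[of 0 1 ?f ?f'] by auto
  with eq have 0: "?f' s = 0" by simp
  define y where "y = exp ((s/2) *\<^sub>R h) * d * exp (((1 - s) / 2) *\<^sub>R k)"
  have "star y = exp (((1 - s) / 2) *\<^sub>R k) * d * exp ((s/2) *\<^sub>R h)"
    using h k by (simp add: y_def d_def star_mult star_diff star_exp star_scaleR selfadjoint_def mult.assoc)
  with 0 have "Re (\<tau> (star y * y)) = 0" by (simp add: trace_exp_conjugation y_def)
  with Re_trace_pos[of y] have "y = 0" by auto
  moreover have "exp (- ((s/2) *\<^sub>R h)) * y * exp (- (((1 - s) / 2) *\<^sub>R k)) =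
      (exp (- ((s/2) *\<^sub>R h)) * exp ((s/2) *\<^sub>R h)) * d *
      (exp (((1 - s) / 2) *\<^sub>R k) * exp (- (((1 - s) / 2) *\<^sub>R k)))"
    by (simp add: y_def mult.assoc)
  ultimately have "d = 0" by (simp only: exp_invertible) simp
  then show ?thesis by (simp add: d_def)
qed

lemma cstar_log_exp: "selfadjoint h \<Longrightarrow> cstar_log (exp h) = (h :: 'a)"
  unfolding cstar_log_def by (rule the_equality) (auto dest: exp_inj_selfadjoint)

lemma exp_cstar_log:
  fixes a :: 'a
  assumes "positive_definite a"
  shows "selfadjoint (cstar_log a)" "exp (cstar_log a) = a"
proof -
  obtain h where "selfadjoint h" "exp h = a"
    using assms by (rule selfadjoint_logarithm_exists)
  then show "selfadjoint (cstar_log a)" "exp (cstar_log a) = a"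
    using cstar_log_exp[of h] by auto
qed

end

section \<open>Quantum Markov semigroups\<close>

text \<open>For \<open>1 \<times> 1\<close> matrices positivity says that squares \<open>y\<^sup>* y\<close> go to squares, which are
  self-adjoint; and every element is a linear combination of squares.\<close>

lemma completely_positive_star:
  assumes lin: "complex_linear_op (T :: 'a::cstar_algebra \<Rightarrow> 'a)" and cp: "completely_positive T"
  shows "T (star x) = star (T x)"
proof -
  have square: "star (T (star y * y)) = T (star y * y)" for y
  proof -
    have "positive_mat 1 (\<lambda>_ _. star y * y)"
      unfolding positive_mat_def by (intro exI[of _ "\<lambda>_ _. y"]) simp
    with cp have "positive_mat 1 (\<lambda>_ _. T (star y * y))"
      unfolding completely_positive_def by (elim allE impE)
    then obtain z where "T (star y * y) = star z * z"
      unfolding positive_mat_def by auto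
    then show ?thesis by (simp add: star_mult star_star)
  qed
  have add: "T (y + z) = T y + T z" for y z using lin by (simp add: complex_linear_op_def)
  \<comment> \<open>A self-adjoint \<open>u\<close> is half the difference of \<open>(u + 1)\<^sup>2\<close> and \<open>u\<^sup>2 + 1\<close>.\<close>
  have sa: "star (T u) = T u" if u: "selfadjoint u" for u
  proof -
    have "star (u + 1) * (u + 1) = star u * u + (u + u) + star 1 * 1"
      using u by (simp add: selfadjoint_def star_add algebra_simps)
    then have eq: "T (star (u + 1) * (u + 1)) = T (star u * u) + (T u + T u) + T (star 1 * 1)"
      by (simp only: add)
    have "T (star u * u) + (star (T u) + star (T u)) + T (star 1 * 1) =
        T (star u * u) + (T u + T u) + T (star 1 * 1)"
      using square[of "u + 1"] unfolding eq by (simp only: star_add square)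
    then have "(2::real) *\<^sub>R star (T u) = (2::real) *\<^sub>R T u" by (simp add: scaleR_2)
    then show ?thesis by simp
  qed
  obtain u v where uv: "selfadjoint u" "selfadjoint v" and x: "x = u + \<i> *\<^sub>C v"
    by (rule selfadjoint_decomposition)
  have scale: "T (c *\<^sub>C y) = c *\<^sub>C T y" for c y using lin by (simp add: complex_linear_op_def)
  have "star x = u + (- \<i>) *\<^sub>C v" using uv by (simp add: x star_add star_scaleC selfadjoint_def)
  then show ?thesis using sa uv by (simp add: x add scale star_add star_scaleC)
qed

locale markov_generator =
  fixes P :: "real \<Rightarrow> 'a::fin_dim_cstar_algebra \<Rightarrow> 'a" and L :: "'a \<Rightarrow> 'a"
  assumes semigroup: "quantum_markov_semigroup P" and generator: "is_generator P L"
begin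

lemma linear_P: "t \<ge> 0 \<Longrightarrow> complex_linear_op (P t)"
  and P_zero: "P 0 a = a"
  and P_add: "s \<ge> 0 \<Longrightarrow> t \<ge> 0 \<Longrightarrow> P (s + t) a = P s (P t a)"
  and P_tendsto: "((\<lambda>t. P t a) \<longlongrightarrow> a) (at_right 0)"
  and cp_P: "t \<ge> 0 \<Longrightarrow> completely_positive (P t)"
  and P_one: "t \<ge> 0 \<Longrightarrow> P t 1 = 1"
  using semigroup by (simp_all add: quantum_markov_semigroup_def)

lemma L_tendsto: "((\<lambda>t. (1 / t) *\<^sub>R (P t a - a)) \<longlongrightarrow> L a) (at_right 0)"
  using generator by (simp add: is_generator_def)

lemma P_star: "t \<ge> 0 \<Longrightarrow> P t (star a) = star (P t a)"
  by (rule completely_positive_star[OF linear_P cp_P])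

lemma P_scaleR: "t \<ge> 0 \<Longrightarrow> P t (r *\<^sub>R a) = r *\<^sub>R P t a"
  and P_plus: "t \<ge> 0 \<Longrightarrow> P t (a + b) = P t a + P t b"
  and P_diff: "t \<ge> 0 \<Longrightarrow> P t (a - b) = P t a - P t b"
proof -
  assume t: "t \<ge> 0"
  show scale: "P t (r *\<^sub>R a) = r *\<^sub>R P t a" for r a
    using linear_P[OF t] by (simp add: complex_linear_op_def scaleC_of_real[symmetric])
  show plus: "P t (a + b) = P t a + P t b" for a b
    using linear_P[OF t] by (simp add: complex_linear_op_def)
  show "P t (a - b) = P t a - P t b"
    using plus[of "a - b" b] by simp
qed

lemma generator_eqI:
  assumes "((\<lambda>t. (1 / t) *\<^sub>R (P t a - a)) \<longlongrightarrow> l) (at_right 0)"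
  shows "L a = l"
  using L_tendsto assms by (rule tendsto_unique[OF trivial_limit_at_right_real])

lemma generator_complex_linear: "complex_linear_op L"
  unfolding complex_linear_op_def
proof (intro conjI allI)
  show "L (a + b) = L a + L b" for a b
  proof (rule generator_eqI)
    have "((\<lambda>t. (1/t) *\<^sub>R (P t a - a) + (1/t) *\<^sub>R (P t b - b)) \<longlongrightarrow> L a + L b) (at_right 0)"
      by (intro tendsto_add L_tendsto)
    then show "((\<lambda>t. (1/t) *\<^sub>R (P t (a + b) - (a + b))) \<longlongrightarrow> L a + L b) (at_right 0)"
      by (rule Lim_transform_eventually)
        (auto simp: eventually_at_right_field P_plus algebra_simps intro!: exI[of _ 1])
  qed
  show "L (c *\<^sub>C a) = c *\<^sub>C L a" for c a
  proof (rule generator_eqI)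
    have "((\<lambda>t. c *\<^sub>C (1/t) *\<^sub>R (P t a - a)) \<longlongrightarrow> c *\<^sub>C L a) (at_right 0)"
      by (intro bounded_linear.tendsto[OF bounded_linear_scaleC] L_tendsto)
    then show "((\<lambda>t. (1/t) *\<^sub>R (P t (c *\<^sub>C a) - c *\<^sub>C a)) \<longlongrightarrow> c *\<^sub>C L a) (at_right 0)"
    proof (rule Lim_transform_eventually)
      have "c *\<^sub>C (1/t) *\<^sub>R (P t a - a) = (1/t) *\<^sub>R (P t (c *\<^sub>C a) - c *\<^sub>C a)" if "t > 0" for t
        using linear_P[of t] that
        by (simp add: complex_linear_op_def scaleC_diff_right[symmetric]
            linear_scale[OF bounded_linear.linear[OF bounded_linear_scaleC]])
      then show "\<forall>\<^sub>F t in at_right 0. c *\<^sub>C (1/t) *\<^sub>R (P t a - a) = (1/t) *\<^sub>R (P t (c *\<^sub>C a) - c *\<^sub>C a)"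
        by (auto simp: eventually_at_right_field intro!: exI[of _ 1])
    qed
  qed
qed

lemma generator_star: "L (star a) = star (L a)"
proof (rule generator_eqI)
  have "((\<lambda>t. star ((1/t) *\<^sub>R (P t a - a))) \<longlongrightarrow> star (L a)) (at_right 0)"
    by (intro bounded_linear.tendsto[OF bounded_linear_star] L_tendsto)
  then show "((\<lambda>t. (1/t) *\<^sub>R (P t (star a) - star a)) \<longlongrightarrow> star (L a)) (at_right 0)"
    by (rule Lim_transform_eventually)
      (auto simp: eventually_at_right_field P_star star_scaleR star_diff intro!: exI[of _ 1])
qed

lemma generator_one: "L 1 = 0"
proof (rule generator_eqI)
  have "((\<lambda>t::real. 0) \<longlongrightarrow> (0::'a)) (at_right 0)" by simp
  then show "((\<lambda>t. (1/t) *\<^sub>R (P t 1 - 1)) \<longlongrightarrow> 0) (at_right 0)"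
    by (rule Lim_transform_eventually)
      (auto simp: eventually_at_right_field P_one intro!: exI[of _ 1])
qed

end

locale markov_generator_with_trace =
  faithful_trace_functional \<tau> + markov_generator P L
  for \<tau> :: "'a::fin_dim_cstar_algebra \<Rightarrow> complex"
    and P :: "real \<Rightarrow> 'a \<Rightarrow> 'a" and L :: "'a \<Rightarrow> 'a"
begin

lemma generator_commutes:
  assumes s: "s \<ge> 0" shows "L (P s a) = P s (L a)"
proof (rule generator_eqI)
  have "((\<lambda>t. P s ((1/t) *\<^sub>R (P t a - a))) \<longlongrightarrow> P s (L a)) (at_right 0)"
    by (intro bounded_linear.tendsto[OF bounded_linear_complex_linear_op[OF linear_P[OF s]]] L_tendsto)
  then show "((\<lambda>t. (1/t) *\<^sub>R (P t (P s a) - P s a)) \<longlongrightarrow> P s (L a)) (at_right 0)"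
  proof (rule Lim_transform_eventually)
    have "P s ((1/t) *\<^sub>R (P t a - a)) = (1/t) *\<^sub>R (P t (P s a) - P s a)" if "t > 0" for t
      using that s P_add[of s t a] P_add[of t s a] by (simp add: P_scaleR P_diff add.commute)
    then show "\<forall>\<^sub>F t in at_right 0. P s ((1/t) *\<^sub>R (P t a - a)) = (1/t) *\<^sub>R (P t (P s a) - P s a)"
      by (auto simp: eventually_at_right_field intro!: exI[of _ 1])
  qed
qed

text \<open>Strong continuity at \<open>0\<close> bounds \<open>P\<^sub>s\<close> at the basis vectors for small \<open>s\<close>, hence in operator
  norm; the semigroup law propagates the bound.\<close>

lemma semigroup_locally_bounded:
  obtains C where "C \<ge> 0" "\<And>s x. 0 \<le> s \<Longrightarrow> s \<le> T \<Longrightarrow> norm (P s x) \<le> C * norm x"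
proof -
  obtain E where E: "orthonormal_basis E" by (rule orthonormal_basis_exists)
  then have fin: "finite E" by (simp add: orthonormal_basis_def)
  obtain C where C: "C \<ge> 0" "\<forall>(T :: 'a \<Rightarrow> 'a) x. complex_linear_op T \<longrightarrow>
      norm (T x) \<le> C * norm x * (\<Sum>e\<in>E. norm (T e))"
    using complex_linear_op_bound[OF E] by (elim exE conjE)
  define D where "D = C * (\<Sum>e\<in>E. norm e + 1)"
  have D: "D \<ge> 0" unfolding D_def using C(1) by (intro mult_nonneg_nonneg sum_nonneg) auto
  have "\<forall>\<^sub>F s in at_right 0. norm (P s e) < norm e + 1" for e
    using tendsto_norm[OF P_tendsto[of e]] by (rule order_tendstoD) simp
  then have "\<forall>\<^sub>F s in at_right 0. \<forall>e\<in>E. norm (P s e) < norm e + 1"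
    using fin by (simp add: eventually_ball_finite_distrib)
  then obtain b where b: "b > 0" "\<And>s. 0 < s \<Longrightarrow> s < b \<Longrightarrow> \<forall>e\<in>E. norm (P s e) < norm e + 1"
    unfolding eventually_at_right_field by blast
  \<comment> \<open>The bound holds on the open interval below \<open>b\<close>; iterating it takes a closed one.\<close>
  define d where "d = b / 2"
  have d: "d > 0" "d < b" using b(1) by (simp_all add: d_def)
  have base: "norm (P s x) \<le> D * norm x" if "0 \<le> s" "s \<le> d" for s x
  proof -
    have "norm (P s e) \<le> norm e + 1" if "e \<in> E" for e
      using b(2)[of s] d that \<open>0 \<le> s\<close> \<open>s \<le> d\<close> by (cases "s = 0") (auto simp: P_zero less_imp_le)
    then have "(\<Sum>e\<in>E. norm (P s e)) \<le> (\<Sum>e\<in>E. norm e + 1)" by (rule sum_mono)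
    then have "C * norm x * (\<Sum>e\<in>E. norm (P s e)) \<le> C * norm x * (\<Sum>e\<in>E. norm e + 1)"
      using C(1) by (intro mult_left_mono) auto
    with C(2)[rule_format, OF linear_P[OF that(1)], of x] show ?thesis by (simp add: D_def mult_ac)
  qed
  have "\<exists>C\<ge>0. \<forall>s x. 0 \<le> s \<longrightarrow> s \<le> real n * d \<longrightarrow> norm (P s x) \<le> C * norm x" for n
  proof (induction n)
    case 0
    show ?case by (intro exI[of _ D]) (use base d D in auto)
  next
    case (Suc n)
    then obtain C where C: "C \<ge> 0" "\<And>s x. 0 \<le> s \<Longrightarrow> s \<le> real n * d \<Longrightarrow> norm (P s x) \<le> C * norm x"
      by blast
    have "norm (P s x) \<le> (D + C * D) * norm x" if s: "0 \<le> s" "s \<le> real (Suc n) * d" for s x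
    proof (cases "s \<le> d")
      case True
      have "D * norm x \<le> (D + C * D) * norm x" using C(1) D by (intro mult_right_mono) auto
      with base[OF s(1) True, of x] show ?thesis by linarith
    next
      case False
      then have "P s x = P (s - d) (P d x)" using P_add[of "s - d" d x] d by simp
      also have "norm \<dots> \<le> C * norm (P d x)"
        using False s by (intro C(2)) (auto simp: algebra_simps)
      also have "\<dots> \<le> C * (D * norm x)" using base[of d x] d C(1) by (intro mult_left_mono) auto
      also have "\<dots> \<le> (D + C * D) * norm x" using D by (simp add: algebra_simps)
      finally show ?thesis .
    qed
    moreover have "0 \<le> D + C * D" using C(1) D by simp
    ultimately show ?case by blast
  qed
  moreover obtain n where "T \<le> real n * d" using d(1) reals_Archimedean3 by (metis less_imp_le)
  ultimately show thesis using that by (meson order_trans)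
qed

text \<open>The generator is defined by a one-sided limit at \<open>0\<close>.  Local boundedness turns it into a
  two-sided derivative, because \<open>P\<^sub>t - P\<^sub>s = P\<^sub>s (P\<^bsub>t-s\<^esub> - 1)\<close> for \<open>s < t\<close> no matter which of
  the two points is the base point.\<close>

lemma semigroup_derivative:
  assumes t: "t \<ge> 0"
  shows "((\<lambda>s. P s a) has_vector_derivative P t (L a)) (at t within {0..})"
  unfolding has_vector_derivative_def has_derivative_within_alt
proof (intro conjI allI impI)
  show "bounded_linear (\<lambda>x. x *\<^sub>R P t (L a))" by (rule bounded_linear_scaleR_left)
  fix e :: real assume e: "e > 0"
  obtain C where C: "C \<ge> 0" "\<And>s x. 0 \<le> s \<Longrightarrow> s \<le> t + 1 \<Longrightarrow> norm (P s x) \<le> C * norm x"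
    by (rule semigroup_locally_bounded[of "t + 1"]) blast
  define e' where "e' = e / (2 * (C + 1))"
  have e': "e' > 0" using e C(1) by (simp add: e'_def)
  have Ce': "2 * (C * e') \<le> e"
    using e C(1) by (simp add: e'_def field_simps)
  have "\<forall>\<^sub>F h in at_right 0. dist ((1/h) *\<^sub>R (P h a - a)) (L a) < e' \<and> dist (P h (L a)) (L a) < e'"
    using tendstoD[OF L_tendsto e'] tendstoD[OF P_tendsto e'] by (rule eventually_conj)
  then obtain b where b: "b > 0" "\<And>h. 0 < h \<Longrightarrow> h < b \<Longrightarrow>
      dist ((1/h) *\<^sub>R (P h a - a)) (L a) < e' \<and> dist (P h (L a)) (L a) < e'"
    unfolding eventually_at_right_field by blast
  have small: "norm (P h a - a - h *\<^sub>R L a) \<le> e' * h" if h: "0 < h" "h < b" for h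
  proof -
    have "P h a - a - h *\<^sub>R L a = h *\<^sub>R ((1/h) *\<^sub>R (P h a - a) - L a)"
      using h by (simp add: scaleR_diff_right)
    then have "norm (P h a - a - h *\<^sub>R L a) = h * dist ((1/h) *\<^sub>R (P h a - a)) (L a)"
      using h by (simp add: dist_norm)
    with b(2)[OF h] h show ?thesis by simp
  qed
  have right: "norm (P (r + h) a - P r a - h *\<^sub>R P r (L a)) \<le> C * (e' * h)"
    and left: "norm (P (r + h) a - P r a - h *\<^sub>R P (r + h) (L a)) \<le> 2 * (C * e') * h"
    if r: "0 \<le> r" "r \<le> t + 1" and h: "0 < h" "h < b" for r h
  proof -
    have "P (r + h) a - P r a - h *\<^sub>R P r (L a) = P r (P h a - a - h *\<^sub>R L a)"
      using r h by (simp add: P_add P_diff P_scaleR)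
    also have "norm \<dots> \<le> C * norm (P h a - a - h *\<^sub>R L a)" using r by (rule C(2))
    also have "\<dots> \<le> C * (e' * h)" using small[OF h] C(1) by (rule mult_left_mono)
    finally show 1: "norm (P (r + h) a - P r a - h *\<^sub>R P r (L a)) \<le> C * (e' * h)" .
    have "norm (P r (P h (L a) - L a)) \<le> C * norm (P h (L a) - L a)" using r by (rule C(2))
    also have "\<dots> \<le> C * e'"
      using b(2)[OF h] C(1) by (intro mult_left_mono) (auto simp: dist_norm)
    finally have 2: "norm (h *\<^sub>R P r (P h (L a) - L a)) \<le> h * (C * e')"
      using h by simp
    have "P (r + h) a - P r a - h *\<^sub>R P (r + h) (L a) =
        (P (r + h) a - P r a - h *\<^sub>R P r (L a)) - h *\<^sub>R P r (P h (L a) - L a)"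
      using r h by (simp add: P_add P_diff scaleR_diff_right)
    also have "norm \<dots> \<le> C * (e' * h) + h * (C * e')"
      using 1 2 by (rule order_trans[OF norm_triangle_ineq4 add_mono])
    finally show "norm (P (r + h) a - P r a - h *\<^sub>R P (r + h) (L a)) \<le> 2 * (C * e') * h"
      by (simp add: mult_ac)
  qed
  show "\<exists>d>0. \<forall>s\<in>{0..}. norm (s - t) < d \<longrightarrow>
      norm (P s a - P t a - (s - t) *\<^sub>R P t (L a)) \<le> e * norm (s - t)"
  proof (intro exI[of _ "min b 1"] conjI ballI impI)
    show "min b 1 > 0" using b(1) by simp
    fix s :: real assume s: "s \<in> {0..}" "norm (s - t) < min b 1"
    consider "s = t" | "s > t" | "s < t" by linarith
    then show "norm (P s a - P t a - (s - t) *\<^sub>R P t (L a)) \<le> e * norm (s - t)"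
    proof cases
      case 2
      have "0 \<le> C * e'" using C(1) e' by simp
      with Ce' have "C * e' \<le> e" by linarith
      with 2 have "C * (e' * (s - t)) \<le> e * (s - t)" by (simp add: mult.assoc[symmetric])
      moreover have "norm (P s a - P t a - (s - t) *\<^sub>R P t (L a)) \<le> C * (e' * (s - t))"
        using right[of t "s - t"] 2 s t by simp
      moreover have "e * norm (s - t) = e * (s - t)" using 2 by simp
      ultimately show ?thesis by linarith
    next
      case 3
      have "P s a - P t a - (s - t) *\<^sub>R P t (L a) = - (P t a - P s a - (t - s) *\<^sub>R P t (L a))"
        by (simp add: algebra_simps)
      then have "norm (P s a - P t a - (s - t) *\<^sub>R P t (L a)) = norm (P t a - P s a - (t - s) *\<^sub>R P t (L a))"
        by (simp only: norm_minus_cancel)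
      moreover have "2 * (C * e') * (t - s) \<le> e * (t - s)"
        using Ce' 3 by (intro mult_right_mono) auto
      moreover have "norm (P t a - P s a - (t - s) *\<^sub>R P t (L a)) \<le> 2 * (C * e') * (t - s)"
        using left[of s "t - s"] 3 s t by simp
      moreover have "e * norm (s - t) = e * (t - s)" using 3 by simp
      ultimately show ?thesis by linarith
    qed simp
  qed
qed

text \<open>An infinitesimal symmetry integrates: \<open>s \<mapsto> \<tau>(P\<^sub>s x M (P\<^bsub>t-s\<^esub> y))\<close> is constant on
  \<open>[0, t]\<close>.\<close>

lemma semigroup_symmetric_of_generator_symmetric:
  fixes M :: "'a \<Rightarrow> 'a"
  assumes M: "bounded_linear M"
    and sym: "\<And>x y. \<tau> (L x * M y) = \<tau> (x * M (L y))"
    and t: "t \<ge> 0"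
  shows "\<tau> (P t x * M y) = \<tau> (x * M (P t y))"
proof -
  let ?F = "\<lambda>s. \<tau> (P s x * M (P (t - s) y))"
  have "(?F has_vector_derivative 0) (at s within {0..t})" if s: "s \<in> {0..t}" for s
  proof -
    have 1: "((\<lambda>s. P s x) has_vector_derivative P s (L x)) (at s within {0..t})"
      using s by (intro has_vector_derivative_within_subset[OF semigroup_derivative]) auto
    have "((\<lambda>s. t - s) has_vector_derivative - 1) (at s within {0..t})"
      by (auto intro!: derivative_eq_intros)
    moreover have "((\<lambda>s. P s y) has_vector_derivative P (t - s) (L y)) (at (t - s) within (\<lambda>s. t - s) ` {0..t})"
      using s by (intro has_vector_derivative_within_subset[OF semigroup_derivative]) auto
    ultimately have "((\<lambda>s. P (t - s) y) has_vector_derivative - P (t - s) (L y)) (at s within {0..t})"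
      using vector_diff_chain_within[of "\<lambda>s. t - s" "- 1" s "{0..t}" "\<lambda>s. P s y"] by (simp add: o_def)
    from bounded_linear.has_vector_derivative[OF M this]
    have 2: "((\<lambda>s. M (P (t - s) y)) has_vector_derivative - M (P (t - s) (L y))) (at s within {0..t})"
      by (simp add: linear_neg[OF bounded_linear.linear[OF M]])
    have "\<tau> (P s x * - M (P (t - s) (L y)) + P s (L x) * M (P (t - s) y)) = 0"
      using s sym[of "P s x" "P (t - s) y"]
      by (simp add: trace_diff generator_commutes)
    with bounded_linear.has_vector_derivative[OF bounded_linear_trace has_vector_derivative_mult[OF 1 2]]
    show ?thesis by simp
  qed
  then obtain c where "\<And>s. s \<in> {0..t} \<Longrightarrow> ?F s = c"
    using has_vector_derivative_zero_constant[of "{0..t}" ?F] by auto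
  from this[of 0] this[of t] t show ?thesis by (simp add: P_zero)
qed

end

section \<open>Continuity of the metric\<close>

context faithful_trace_functional
begin

lemma tangentD: "v \<in> tangent \<tau> \<Longrightarrow> selfadjoint v" "v \<in> tangent \<tau> \<Longrightarrow> \<tau> v = 0"
  by (simp_all add: tangent_def)

lemma tangent_zero: "0 \<in> tangent \<tau>"
  and tangent_add: "v \<in> tangent \<tau> \<Longrightarrow> w \<in> tangent \<tau> \<Longrightarrow> v + w \<in> tangent \<tau>"
  and tangent_scaleR: "v \<in> tangent \<tau> \<Longrightarrow> r *\<^sub>R v \<in> tangent \<tau>"
  by (auto simp: tangent_def selfadjoint_def star_add star_scaleR trace_add trace_scaleR)

lemma tangent_sum: "(\<And>i. i \<in> I \<Longrightarrow> f i \<in> tangent \<tau>) \<Longrightarrow> (\<Sum>i\<in>I. f i) \<in> tangent \<tau>"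
  by (induction I rule: infinite_finite_induct) (auto simp: tangent_zero tangent_add)

lemma tangent_closed:
  assumes "(f \<longlongrightarrow> v) F" "F \<noteq> bot" "\<forall>\<^sub>F x in F. f x \<in> tangent \<tau>"
  shows "v \<in> tangent \<tau>"
proof -
  have "((\<lambda>x. star (f x)) \<longlongrightarrow> star v) F"
    by (rule bounded_linear.tendsto[OF bounded_linear_star assms(1)])
  moreover have "((\<lambda>x. star (f x)) \<longlongrightarrow> v) F"
    by (rule Lim_transform_eventually[OF assms(1)], rule eventually_mono[OF assms(3)])
      (simp add: tangent_def selfadjoint_def)
  ultimately have "star v = v" by (rule tendsto_unique[OF assms(2)])
  have "((\<lambda>x. \<tau> (f x)) \<longlongrightarrow> \<tau> v) F"
    by (rule tendsto_trace[OF assms(1)])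
  moreover have "((\<lambda>x. \<tau> (f x)) \<longlongrightarrow> 0) F"
    by (rule tendsto_eventually, rule eventually_mono[OF assms(3)]) (simp add: tangent_def)
  ultimately have "\<tau> v = 0" by (rule tendsto_unique[OF assms(2)])
  with \<open>star v = v\<close> show ?thesis by (simp add: tangent_def selfadjoint_def)
qed

definition traceless_part :: "'a \<Rightarrow> 'a" where
  "traceless_part x = x - (Re (\<tau> x) / Re (\<tau> 1)) *\<^sub>R 1"

lemma traceless_part_tangent:
  assumes "selfadjoint x" shows "traceless_part x \<in> tangent \<tau>"
proof -
  have "Re (\<tau> 1) > 0" "Im (\<tau> 1) = 0"
    using Re_trace_pos[of 1] Im_trace_square[of 1] by simp_all
  moreover have "Im (\<tau> x) = 0" using assms by (rule trace_selfadjoint_real)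
  ultimately have "\<tau> (traceless_part x) = 0"
    by (simp add: traceless_part_def trace_diff trace_scaleR complex_eq_iff)
  with assms show ?thesis
    by (simp add: tangent_def traceless_part_def selfadjoint_def star_diff star_scaleR)
qed

lemma traceless_part_add: "traceless_part (x + y) = traceless_part x + traceless_part y"
  by (simp add: traceless_part_def trace_add add_divide_distrib scaleR_add_left)

lemma traceless_part_scaleR: "traceless_part (r *\<^sub>R x) = r *\<^sub>R traceless_part x"
  by (simp add: traceless_part_def trace_scaleR scaleR_diff_right)

lemma traceless_part_sum: "traceless_part (\<Sum>i\<in>I. f i) = (\<Sum>i\<in>I. traceless_part (f i))"
  by (induction I rule: infinite_finite_induct)
    (simp_all add: traceless_part_add, simp_all add: traceless_part_def)

text \<open>The real coordinates of a tangent vector are the real and imaginary parts of its coefficients in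
  a complex orthonormal basis \<open>e\<close>; the spanning vectors are the traceless parts of
  \<open>(e + e\<^sup>*)/2\<close> and \<open>i(e - e\<^sup>*)/2\<close>.\<close>

lemma tangent_coordinates:
  obtains E and u w :: "'a \<Rightarrow> 'a" where "finite E"
    "\<And>e. u e \<in> tangent \<tau>" "\<And>e. w e \<in> tangent \<tau>"
    "\<And>v. v \<in> tangent \<tau> \<Longrightarrow>
      v = (\<Sum>e\<in>E. Re (\<tau> (star e * v)) *\<^sub>R u e + Im (\<tau> (star e * v)) *\<^sub>R w e)"
proof -
  obtain E where E: "orthonormal_basis E" by (rule orthonormal_basis_exists)
  define u0 where "u0 e = (1/2) *\<^sub>R (e + star e)" for e :: 'a
  define w0 where "w0 e = (1/2) *\<^sub>R \<i> *\<^sub>C (e - star e)" for e :: 'a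
  have u0: "selfadjoint (u0 e)" and w0: "selfadjoint (w0 e)" for e
    by (simp_all add: selfadjoint_def u0_def w0_def star_scaleR star_add star_diff star_star star_scaleC
        add.commute scaleC_minus_left scaleC_diff_right)
  have split: "(1/2) *\<^sub>R (c *\<^sub>C e + cnj c *\<^sub>C star e) = Re c *\<^sub>R u0 e + Im c *\<^sub>R w0 e" for c e
  proof -
    have "Re c *\<^sub>R u0 e + Im c *\<^sub>R w0 e =
        (1/2) *\<^sub>R (Re c *\<^sub>R (e + star e) + Im c *\<^sub>R \<i> *\<^sub>C (e - star e))"
      by (simp add: u0_def w0_def scaleR_add_right)
    also have "Re c *\<^sub>R (e + star e) + Im c *\<^sub>R \<i> *\<^sub>C (e - star e) =
        (of_real (Re c) + of_real (Im c) * \<i>) *\<^sub>C e + (of_real (Re c) - of_real (Im c) * \<i>) *\<^sub>C star e"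
      by (simp only: scaleC_of_real[symmetric] scaleC_scaleC scaleC_add_left scaleC_diff_left
          scaleC_add_right scaleC_diff_right) simp
    also have "of_real (Re c) + of_real (Im c) * \<i> = c" by (simp add: complex_eq_iff)
    also have "of_real (Re c) - of_real (Im c) * \<i> = cnj c" by (simp add: complex_eq_iff)
    finally show ?thesis by simp
  qed
  show thesis
  proof (rule that)
    show "finite E" using E by (simp add: orthonormal_basis_def)
    show "traceless_part (u0 e) \<in> tangent \<tau>" "traceless_part (w0 e) \<in> tangent \<tau>" for e
      by (rule traceless_part_tangent, rule u0 w0)+
    fix v assume v: "v \<in> tangent \<tau>"
    have ex: "v = (\<Sum>e\<in>E. \<tau> (star e * v) *\<^sub>C e)"
      using E unfolding orthonormal_basis_def by blast
    from arg_cong[OF this, of star] v have ex': "v = (\<Sum>e\<in>E. cnj (\<tau> (star e * v)) *\<^sub>C star e)"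
      by (simp add: tangent_def selfadjoint_def star_sum star_scaleC)
    have "v = (1/2) *\<^sub>R (v + v)" by (simp add: scaleR_2[symmetric])
    also have "v + v = (\<Sum>e\<in>E. \<tau> (star e * v) *\<^sub>C e + cnj (\<tau> (star e * v)) *\<^sub>C star e)"
      by (subst sum.distrib) (rule arg_cong2[OF ex ex'])
    also have "(1/2) *\<^sub>R \<dots> = (\<Sum>e\<in>E. Re (\<tau> (star e * v)) *\<^sub>R u0 e + Im (\<tau> (star e * v)) *\<^sub>R w0 e)"
      by (simp only: scaleR_sum_right split)
    finally have "traceless_part v =
        traceless_part (\<Sum>e\<in>E. Re (\<tau> (star e * v)) *\<^sub>R u0 e + Im (\<tau> (star e * v)) *\<^sub>R w0 e)"
      by (rule arg_cong)
    moreover have "traceless_part v = v"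
      using v by (simp add: traceless_part_def tangent_def)
    ultimately show "v = (\<Sum>e\<in>E. Re (\<tau> (star e * v)) *\<^sub>R traceless_part (u0 e) +
        Im (\<tau> (star e * v)) *\<^sub>R traceless_part (w0 e))"
      by (simp add: traceless_part_sum traceless_part_add traceless_part_scaleR)
  qed
qed

lemma metric_add_right:
  assumes "riemannian_metric \<tau> g" "\<rho> \<in> states_pos \<tau>" "A \<in> tangent \<tau>" "B \<in> tangent \<tau>" "C \<in> tangent \<tau>"
  shows "g \<rho> A (B + C) = g \<rho> A B + g \<rho> A C"
  using assms tangent_add[OF assms(4,5)] unfolding riemannian_metric_def by metis

lemma metric_scaleR_right:
  assumes "riemannian_metric \<tau> g" "\<rho> \<in> states_pos \<tau>" "A \<in> tangent \<tau>" "B \<in> tangent \<tau>"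
  shows "g \<rho> A (r *\<^sub>R B) = r * g \<rho> A B"
  using assms tangent_scaleR[OF assms(4)] unfolding riemannian_metric_def by metis

lemma metric_sum_right:
  assumes "riemannian_metric \<tau> g" "\<rho> \<in> states_pos \<tau>" "A \<in> tangent \<tau>" "\<And>i. i \<in> I \<Longrightarrow> f i \<in> tangent \<tau>"
  shows "g \<rho> A (\<Sum>i\<in>I. f i) = (\<Sum>i\<in>I. g \<rho> A (f i))"
proof -
  have "g \<rho> A 0 = 0"
    using metric_scaleR_right[OF assms(1,2,3) tangent_zero, of 0] by simp
  then show ?thesis using assms(4)
    by (induction I rule: infinite_finite_induct)
      (simp_all add: metric_add_right[OF assms(1,2,3)] tangent_sum)
qed

text \<open>The hypothesis gives continuity of \<open>\<rho> \<mapsto> g\<^sub>\<rho>(A, B)\<close> only for fixed \<open>A\<close> and \<open>B\<close>; expanding the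
  second argument in coordinates makes it joint.\<close>

lemma metric_tendsto:
  assumes g: "riemannian_metric \<tau> g" "C1_metric \<tau> g"
    and \<rho>: "(\<rho> \<longlongrightarrow> \<rho>0) F" "\<forall>\<^sub>F x in F. \<rho> x \<in> states_pos \<tau>" "\<rho>0 \<in> states_pos \<tau>"
    and v: "(v \<longlongrightarrow> v0) F" "\<forall>\<^sub>F x in F. v x \<in> tangent \<tau>" "v0 \<in> tangent \<tau>"
    and A: "A \<in> tangent \<tau>"
  shows "((\<lambda>x. g (\<rho> x) A (v x)) \<longlongrightarrow> g \<rho>0 A v0) F"
proof -
  obtain E and u w :: "'a \<Rightarrow> 'a" where E: "finite E"
    and u: "\<And>e. u e \<in> tangent \<tau>" and w: "\<And>e. w e \<in> tangent \<tau>"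
    and ex: "\<And>v. v \<in> tangent \<tau> \<Longrightarrow>
      v = (\<Sum>e\<in>E. Re (\<tau> (star e * v)) *\<^sub>R u e + Im (\<tau> (star e * v)) *\<^sub>R w e)"
    by (rule tangent_coordinates) blast
  define G where "G r B = (\<Sum>e\<in>E. Re (\<tau> (star e * B)) * g r A (u e) + Im (\<tau> (star e * B)) * g r A (w e))" for r B
  have G: "g r A B = G r B" if "r \<in> states_pos \<tau>" "B \<in> tangent \<tau>" for r B
  proof -
    have "g r A B = g r A (\<Sum>e\<in>E. Re (\<tau> (star e * B)) *\<^sub>R u e + Im (\<tau> (star e * B)) *\<^sub>R w e)"
      by (rule arg_cong[OF ex[OF that(2)]])
    also have "\<dots> = G r B"
      unfolding G_def using u w
      by (simp add: metric_sum_right[OF g(1) that(1) A] metric_add_right[OF g(1) that(1) A]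
          metric_scaleR_right[OF g(1) that(1) A] tangent_add tangent_scaleR)
    finally show ?thesis .
  qed
  have cont: "((\<lambda>x. g (\<rho> x) A B) \<longlongrightarrow> g \<rho>0 A B) F" if B: "B \<in> tangent \<tau>" for B
  proof -
    obtain D :: "'a \<Rightarrow> 'a \<Rightarrow>\<^sub>L real" where
      "\<forall>r\<in>states_pos \<tau>. ((\<lambda>r. g r A B) has_derivative blinfun_apply (D r)) (at r within states_pos \<tau>)"
      using g(2) A B unfolding C1_metric_def by blast
    then have "continuous (at \<rho>0 within states_pos \<tau>) (\<lambda>r. g r A B)"
      using \<rho>(3) has_derivative_continuous by blast
    then show ?thesis using \<rho>(2,1) by (rule continuous_within_tendsto_compose)
  qed
  have coord: "((\<lambda>x. \<tau> (star e * v x)) \<longlongrightarrow> \<tau> (star e * v0)) F" for e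
    by (intro tendsto_trace tendsto_mult tendsto_const v(1))
  have "((\<lambda>x. G (\<rho> x) (v x)) \<longlongrightarrow> G \<rho>0 v0) F"
    unfolding G_def by (intro tendsto_intros coord cont u w)
  then have "((\<lambda>x. g (\<rho> x) A (v x)) \<longlongrightarrow> G \<rho>0 v0) F"
    by (rule Lim_transform_eventually) (use \<rho>(2) v(2) in eventually_elim, simp add: G)
  with G[OF \<rho>(3) v(3)] show ?thesis by simp
qed

section \<open>The BKM inner product as a trace pairing\<close>

text \<open>Cyclicity of the trace interchanges \<open>x\<close> and \<open>y\<close> at the price of \<open>s \<mapsto> 1 - s\<close>.\<close>

lemma bkm_op_symmetric: "\<tau> (x * bkm_op h y) = \<tau> (y * bkm_op h x)"
proof -
  define f where "f s = \<tau> (x * (exp (s *\<^sub>R h) * y * exp ((1 - s) *\<^sub>R h)))" for s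
  have lin: "bounded_linear (\<lambda>z. \<tau> (b * z))" for b
    by (intro bounded_linear_compose[OF bounded_linear_trace] bounded_linear_mult_right)
  have "(f has_integral \<tau> (x * bkm_op h y)) (cbox 0 1)"
    using has_integral_linear[OF has_integral_bkm_op lin[of x], of h y] by (simp add: f_def[abs_def] o_def)
  from has_integral_affinity[OF this, of "-1" 1]
  have "((\<lambda>s. f (1 - s)) has_integral \<tau> (x * bkm_op h y)) ((\<lambda>s. 1 - s) ` {0..1})"
    by simp
  then have "((\<lambda>s. f (1 - s)) has_integral \<tau> (x * bkm_op h y)) {0..1}"
    by (simp add: image_diff_atLeastAtMost)
  moreover have "f (1 - s) = \<tau> (y * (exp (s *\<^sub>R h) * x * exp ((1 - s) *\<^sub>R h)))" for s
    using trace_commute[of "x * exp ((1 - s) *\<^sub>R h)" "y * exp (s *\<^sub>R h)"]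
    by (simp add: f_def mult.assoc trace_commute[of "exp ((1 - s) *\<^sub>R h)" "y * (exp (s *\<^sub>R h) * x)", symmetric])
  ultimately have "((\<lambda>s. \<tau> (y * (exp (s *\<^sub>R h) * x * exp ((1 - s) *\<^sub>R h)))) has_integral
      \<tau> (x * bkm_op h y)) {0..1}"
    by simp
  moreover have "((\<lambda>s. \<tau> (y * (exp (s *\<^sub>R h) * x * exp ((1 - s) *\<^sub>R h)))) has_integral
      \<tau> (y * bkm_op h x)) {0..1}"
    using has_integral_linear[OF has_integral_bkm_op lin[of y], of h x] by (simp add: o_def)
  ultimately show ?thesis by (rule has_integral_unique)
qed

lemma bkm_inner_eq_trace: "bkm_inner \<tau> \<sigma> a b = \<tau> (star a * bkm_op (cstar_log \<sigma>) b)"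
proof -
  have "bounded_linear (\<lambda>z. \<tau> (star a * z))"
    by (intro bounded_linear_compose[OF bounded_linear_trace] bounded_linear_mult_right)
  from has_integral_linear[OF has_integral_bkm_op this, of "cstar_log \<sigma>" b] show ?thesis
    unfolding bkm_inner_def cstar_powr_def by (intro integral_unique) (simp add: o_def mult.assoc)
qed

end

section \<open>Linearization of the gradient flow at the invariant state\<close>

context markov_generator_with_trace
begin

lemma dual_generator: "\<tau> (a * tr_adjoint \<tau> L x) = \<tau> (L a * x)"
  using tr_adjoint_property[OF generator_complex_linear, of "star a" x]
  by (simp add: generator_star star_star)

lemma dual_generator_complex_linear: "complex_linear_op (tr_adjoint \<tau> L)"
  unfolding complex_linear_op_def
  by (intro conjI allI trace_mult_eqI)
    (simp_all add: dual_generator distrib_left trace_add mult_scaleC_right trace_scaleC)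

lemma dual_generator_star: "tr_adjoint \<tau> L (star x) = star (tr_adjoint \<tau> L x)"
proof (rule trace_mult_eqI)
  fix b
  have "\<tau> (b * star (tr_adjoint \<tau> L x)) = cnj (\<tau> (star b * tr_adjoint \<tau> L x))"
    by (subst trace_star[symmetric]) (simp add: star_mult star_star trace_commute)
  also have "\<dots> = \<tau> (b * tr_adjoint \<tau> L (star x))"
    unfolding dual_generator generator_star
    by (subst trace_star[symmetric]) (simp add: star_mult star_star trace_commute)
  finally show "\<tau> (b * tr_adjoint \<tau> L (star x)) = \<tau> (b * star (tr_adjoint \<tau> L x))" ..
qed

text \<open>Trace zero is dual to \<open>L 1 = 0\<close>.\<close>

lemma dual_generator_tangent:
  assumes "selfadjoint x" shows "tr_adjoint \<tau> L x \<in> tangent \<tau>"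
  using assms dual_generator_star[of x] dual_generator[of 1 x]
  by (simp add: tangent_def selfadjoint_def generator_one)

lemma dual_generator_invariant:
  assumes inv: "\<forall>t\<ge>0. tr_adjoint \<tau> (P t) \<sigma> = \<sigma>"
  shows "tr_adjoint \<tau> L \<sigma> = 0"
proof (rule trace_mult_eqI)
  fix a
  have P: "\<tau> (P t a * \<sigma>) = \<tau> (a * \<sigma>)" if "t \<ge> 0" for t
    using tr_adjoint_property[OF linear_P[OF that], of "star a" \<sigma>] inv that
    by (simp add: P_star star_star)
  have "((\<lambda>t. \<tau> ((1/t) *\<^sub>R (P t a - a) * \<sigma>)) \<longlongrightarrow> \<tau> (L a * \<sigma>)) (at_right 0)"
    by (intro tendsto_trace tendsto_mult tendsto_const L_tendsto)
  moreover have "((\<lambda>t. \<tau> ((1/t) *\<^sub>R (P t a - a) * \<sigma>)) \<longlongrightarrow> 0) (at_right 0)"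
    by (rule tendsto_eventually)
      (auto simp: eventually_at_right_field P trace_scaleR left_diff_distrib trace_diff intro!: exI[of _ 1])
  ultimately have "\<tau> (L a * \<sigma>) = 0" by (rule tendsto_unique[OF trivial_limit_at_right_real])
  then show "\<tau> (a * tr_adjoint \<tau> L \<sigma>) = \<tau> (a * 0)" by (simp add: dual_generator)
qed

text \<open>The gradient flow equation is tested along the curve
  \<open>\<rho>\<^sub>e = exp (log \<sigma> + e x) / \<tau>(exp (log \<sigma> + e x))\<close>.  Its logarithm is known exactly, so the right-hand
  side is \<open>- e \<tau>(a x)\<close> without any error term, while
  \<open>L\<^sup>\<dagger> \<rho>\<^sub>e / e \<rightarrow> L\<^sup>\<dagger> (bkm_op (log \<sigma>) x)\<close>.\<close>

lemma gradient_flow_linearized: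
  assumes \<sigma>: "\<sigma> \<in> states_pos \<tau>"
    and inv: "\<forall>t\<ge>0. tr_adjoint \<tau> (P t) \<sigma> = \<sigma>"
    and g: "riemannian_metric \<tau> g" "C1_metric \<tau> g"
    and flow: "\<forall>\<rho>\<in>states_pos \<tau>. \<forall>A\<in>tangent \<tau>.
           complex_of_real (g \<rho> A (tr_adjoint \<tau> L \<rho>)) = - \<tau> (A * (cstar_log \<rho> - cstar_log \<sigma>))"
    and x: "selfadjoint x"
  defines "Mx \<equiv> bkm_op (cstar_log \<sigma>) x"
  shows "tr_adjoint \<tau> L Mx \<in> tangent \<tau>"
    and "A \<in> tangent \<tau> \<Longrightarrow> g \<sigma> A (tr_adjoint \<tau> L Mx) = - Re (\<tau> (A * x))"
proof -
  define h where "h = cstar_log \<sigma>"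
  have h: "selfadjoint h" "exp h = \<sigma>"
    using exp_cstar_log[of \<sigma>] \<sigma> by (simp_all add: h_def states_pos_def)
  define K where "K = tr_adjoint \<tau> L"
  have K: "bounded_linear K"
    unfolding K_def by (intro bounded_linear_complex_linear_op dual_generator_complex_linear)
  note K_linear = bounded_linear.linear[OF K]
  define z where "z e = h + e *\<^sub>R x" for e
  define c where "c e = ln (Re (\<tau> (exp (z e))))" for e
  define k where "k e = z e - c e *\<^sub>R 1" for e
  define \<rho> where "\<rho> e = exp (k e)" for e
  define q where "q e = (exp (z e) - \<sigma>) /\<^sub>R e" for e
  have z: "selfadjoint (z e)" for e
    using h(1) x by (simp add: z_def selfadjoint_def star_add star_scaleR)
  then have k: "selfadjoint (k e)" for e
    by (simp add: k_def selfadjoint_def star_diff star_scaleR)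
  have \<rho>_eq: "\<rho> e = exp (- c e) *\<^sub>R exp (z e)" for e
  proof -
    have "exp (k e) = exp (of_real (- c e) + z e)"
      by (simp add: k_def of_real_def)
    also have "\<dots> = exp (of_real (- c e)) * exp (z e)"
      by (rule exp_add_commuting) (simp add: of_real_def)
    also have "\<dots> = exp (- c e) *\<^sub>R exp (z e)"
      unfolding exp_of_real by (simp add: of_real_def)
    finally show ?thesis by (simp add: \<rho>_def)
  qed
  have trace_exp: "0 < Re (\<tau> (exp (z e)))" "\<tau> (exp (z e)) = of_real (Re (\<tau> (exp (z e))))" for e
  proof -
    let ?y = "exp ((1/2) *\<^sub>R z e)"
    have y: "star ?y * ?y = exp (z e)"
      using exp_half_mult[of 1 "z e"] z[of e] by (simp add: star_exp star_scaleR selfadjoint_def)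
    have "?y \<noteq> 0" using exp_invertible(1)[of "(1/2) *\<^sub>R z e"] by auto
    from Re_trace_pos[OF this] show "0 < Re (\<tau> (exp (z e)))" unfolding y .
    show "\<tau> (exp (z e)) = of_real (Re (\<tau> (exp (z e))))"
      using Im_trace_square[of ?y] unfolding y by (simp add: complex_eq_iff)
  qed
  have \<rho>: "\<rho> e \<in> states_pos \<tau>" for e
  proof -
    have "\<tau> (\<rho> e) = of_real (exp (- c e) * Re (\<tau> (exp (z e))))"
      unfolding \<rho>_eq trace_scaleR by (subst trace_exp(2)) simp
    also have "\<dots> = 1" using trace_exp(1)[of e] by (simp add: c_def exp_minus)
    finally show ?thesis
      using positive_definite_exp[OF k[of e]] by (simp add: states_pos_def \<rho>_def)
  qed
  have q: "(q \<longlongrightarrow> Mx) (at 0)"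
    using exp_directional_derivative[of h x] unfolding q_def[abs_def] z_def Mx_def h_def[symmetric] h(2) .
  have z_lim: "((\<lambda>e. exp (z e)) \<longlongrightarrow> \<sigma>) (at 0)"
  proof -
    have "((\<lambda>e. \<sigma> + e *\<^sub>R q e) \<longlongrightarrow> \<sigma> + 0 *\<^sub>R Mx) (at 0)" by (intro tendsto_intros q)
    then have "((\<lambda>e. \<sigma> + e *\<^sub>R q e) \<longlongrightarrow> \<sigma>) (at 0)" by simp
    moreover have "\<forall>\<^sub>F e in at 0. \<sigma> + e *\<^sub>R q e = exp (z e)"
      by (auto simp: eventually_at_filter q_def)
    ultimately show ?thesis by (rule Lim_transform_eventually)
  qed
  have c: "(c \<longlongrightarrow> 0) (at 0)"
  proof -
    have "((\<lambda>e. ln (Re (\<tau> (exp (z e))))) \<longlongrightarrow> ln (Re (\<tau> \<sigma>))) (at 0)"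
      using \<sigma> by (intro tendsto_ln tendsto_Re tendsto_trace z_lim) (simp add: states_pos_def)
    then show ?thesis using \<sigma> by (simp add: c_def[abs_def] states_pos_def)
  qed
  have \<rho>_lim: "(\<rho> \<longlongrightarrow> \<sigma>) (at 0)"
  proof -
    have "((\<lambda>e. exp (- c e) *\<^sub>R exp (z e)) \<longlongrightarrow> exp (- 0) *\<^sub>R \<sigma>) (at 0)"
      by (intro tendsto_intros c z_lim)
    then show ?thesis by (simp add: \<rho>_eq[abs_def])
  qed
  define v where "v e = (1/e) *\<^sub>R K (\<rho> e)" for e
  have K_tangent: "K (\<rho> e) \<in> tangent \<tau>" for e
    unfolding K_def \<rho>_def by (intro dual_generator_tangent selfadjoint_exp k)
  then have v_tangent: "v e \<in> tangent \<tau>" for e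
    unfolding v_def by (rule tangent_scaleR)
  have v_eq: "v e = exp (- c e) *\<^sub>R K (q e)" for e
    using dual_generator_invariant[OF inv]
    by (simp add: v_def \<rho>_eq q_def K_def[symmetric] linear_scale[OF K_linear] linear_diff[OF K_linear]
        divide_inverse mult.commute)
  have v: "(v \<longlongrightarrow> K Mx) (at 0)"
  proof -
    have "((\<lambda>e. exp (- c e) *\<^sub>R K (q e)) \<longlongrightarrow> exp (- 0) *\<^sub>R K Mx) (at 0)"
      by (intro tendsto_intros c bounded_linear.tendsto[OF K q])
    then show ?thesis by (simp add: v_eq[abs_def])
  qed
  have lim_tangent: "K Mx \<in> tangent \<tau>"
    by (rule tangent_closed[OF v]) (simp_all add: v_tangent)
  then show "tr_adjoint \<tau> L Mx \<in> tangent \<tau>" by (simp add: K_def)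
  assume A: "A \<in> tangent \<tau>"
  have "g (\<rho> e) A (v e) = - Re (\<tau> (A * x))" if "e \<noteq> 0" for e
  proof -
    have "complex_of_real (g (\<rho> e) A (K (\<rho> e))) = - \<tau> (A * (k e - h))"
      using flow \<rho>[of e] A cstar_log_exp[OF k[of e]]
      by (simp add: K_def h_def \<rho>_def)
    also have "\<dots> = - (of_real e * \<tau> (A * x))"
      using tangentD(2)[OF A]
      by (simp add: k_def z_def right_diff_distrib trace_diff trace_scaleR)
    finally have "complex_of_real (g (\<rho> e) A (K (\<rho> e))) = - (of_real e * \<tau> (A * x))" .
    from arg_cong[OF this, of Re] have "g (\<rho> e) A (K (\<rho> e)) = - (e * Re (\<tau> (A * x)))"
      by simp
    then show ?thesis
      unfolding v_def metric_scaleR_right[OF g(1) \<rho> A K_tangent] using that by simp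
  qed
  then have "((\<lambda>e. g (\<rho> e) A (v e)) \<longlongrightarrow> - Re (\<tau> (A * x))) (at 0)"
    by (intro tendsto_eventually) (simp add: eventually_at_filter)
  moreover have "((\<lambda>e. g (\<rho> e) A (v e)) \<longlongrightarrow> g \<sigma> A (K Mx)) (at 0)"
    using \<rho> v_tangent by (intro metric_tendsto g \<rho>_lim \<sigma> v lim_tangent A) simp_all
  ultimately show "g \<sigma> A (tr_adjoint \<tau> L Mx) = - Re (\<tau> (A * x))"
    unfolding K_def[symmetric] by (intro tendsto_unique[OF _ _]) simp_all
qed

text \<open>The point is that \<open>L\<^sup>\<dagger> (M y)\<close> is itself a tangent vector and may be inserted for the free slot of
  the linearized equation; both sides of \<open>g(L\<^sup>\<dagger> M x, L\<^sup>\<dagger> M y) = g(L\<^sup>\<dagger> M y, L\<^sup>\<dagger> M x)\<close> are then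
  known explicitly.\<close>

lemma generator_bkm_symmetric:
  assumes \<sigma>: "\<sigma> \<in> states_pos \<tau>"
    and inv: "\<forall>t\<ge>0. tr_adjoint \<tau> (P t) \<sigma> = \<sigma>"
    and g: "riemannian_metric \<tau> g" "C1_metric \<tau> g"
    and flow: "\<forall>\<rho>\<in>states_pos \<tau>. \<forall>A\<in>tangent \<tau>.
           complex_of_real (g \<rho> A (tr_adjoint \<tau> L \<rho>)) = - \<tau> (A * (cstar_log \<rho> - cstar_log \<sigma>))"
  defines "M \<equiv> bkm_op (cstar_log \<sigma>)"
  shows "\<tau> (L x * M y) = \<tau> (x * M (L y))"
proof -
  note lin = gradient_flow_linearized[OF \<sigma> inv g flow, folded M_def]
  have sa: "\<tau> (L x * M y) = \<tau> (L y * M x)" if x: "selfadjoint x" and y: "selfadjoint y" for x y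
  proof -
    let ?a = "tr_adjoint \<tau> L (M x)" and ?b = "tr_adjoint \<tau> L (M y)"
    have "g \<sigma> ?a ?b = g \<sigma> ?b ?a"
      using g(1) \<sigma> lin(1)[OF x] lin(1)[OF y] unfolding riemannian_metric_def by blast
    then have "Re (\<tau> (?a * y)) = Re (\<tau> (?b * x))"
      using lin(2)[OF x lin(1)[OF y]] lin(2)[OF y lin(1)[OF x]] by simp
    moreover have "Im (\<tau> (?a * y)) = 0" "Im (\<tau> (?b * x)) = 0"
      using trace_selfadjoint_mult_real tangentD(1) lin(1) x y by blast+
    ultimately have "\<tau> (y * ?a) = \<tau> (x * ?b)"
      by (simp add: complex_eq_iff trace_commute)
    then show ?thesis by (simp add: dual_generator)
  qed
  have "\<tau> (L x * M y) = \<tau> (L y * M x)"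
  proof -
    obtain u v where uv: "selfadjoint u" "selfadjoint v" and x: "x = u + \<i> *\<^sub>C v"
      by (rule selfadjoint_decomposition)
    obtain u' v' where uv': "selfadjoint u'" "selfadjoint v'" and y: "y = u' + \<i> *\<^sub>C v'"
      by (rule selfadjoint_decomposition)
    have L: "L (a + c *\<^sub>C b) = L a + c *\<^sub>C L b" for a b c
      using generator_complex_linear by (simp add: complex_linear_op_def)
    have M: "M (a + c *\<^sub>C b) = M a + c *\<^sub>C M b" for a b c
      using complex_linear_bkm_op[of "cstar_log \<sigma>"] by (simp add: complex_linear_op_def M_def)
    show ?thesis
      unfolding x y L M using sa uv uv'
      by (simp add: distrib_left distrib_right trace_add mult_scaleC_left mult_scaleC_right trace_scaleC
          algebra_simps)
  qed
  also have "\<dots> = \<tau> (x * M (L y))" unfolding M_def by (rule bkm_op_symmetric)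
  finally show ?thesis .
qed

end

theorem theorem2p9:
  fixes \<tau> :: "'a::fin_dim_cstar_algebra \<Rightarrow> complex"
    and P :: "real \<Rightarrow> 'a \<Rightarrow> 'a"
    and L :: "'a \<Rightarrow> 'a"
    and \<sigma> :: 'a
    and g :: "'a \<Rightarrow> 'a \<Rightarrow> 'a \<Rightarrow> real"
  assumes "faithful_trace \<tau>"
    and "quantum_markov_semigroup P"
    and "is_generator P L"
    and "ergodic_generator L"
    and "\<sigma> \<in> states_pos \<tau>"
    and "\<forall>t\<ge>0. tr_adjoint \<tau> (P t) \<sigma> = \<sigma>"
    and "riemannian_metric \<tau> g"
    and "C1_metric \<tau> g"
    and "\<forall>\<rho>\<in>states_pos \<tau>. \<forall>A\<in>tangent \<tau>.
           complex_of_real (g \<rho> A (tr_adjoint \<tau> L \<rho>)) = - \<tau> (A * (cstar_log \<rho> - cstar_log \<sigma>))"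
  shows "\<forall>t\<ge>0. \<forall>A B. bkm_inner \<tau> \<sigma> (P t A) B = bkm_inner \<tau> \<sigma> A (P t B)"
proof (intro allI impI)
  interpret markov_generator_with_trace \<tau> P L
    by unfold_locales (rule assms)+
  fix t :: real and A B :: 'a
  assume t: "t \<ge> 0"
  have "bounded_linear (bkm_op (cstar_log \<sigma>))"
    by (intro bounded_linear_complex_linear_op complex_linear_bkm_op)
  moreover have "\<tau> (L x * bkm_op (cstar_log \<sigma>) y) = \<tau> (x * bkm_op (cstar_log \<sigma>) (L y))" for x y
    using assms(5-9) by (rule generator_bkm_symmetric)
  ultimately have "\<tau> (P t (star A) * bkm_op (cstar_log \<sigma>) B) = \<tau> (star A * bkm_op (cstar_log \<sigma>) (P t B))"
    using t by (rule semigroup_symmetric_of_generator_symmetric)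
  then show "bkm_inner \<tau> \<sigma> (P t A) B = bkm_inner \<tau> \<sigma> A (P t B)"
    using t by (simp add: bkm_inner_eq_trace P_star)
qed

end
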